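(* Let $n>r>0$ be integers, let $X_P$, $P=P_{n,r}$, be the special fiber of the Gelfand--Cetlin toric degeneration of $\mathrm{Gr}(n,r)$, and let $X_Q$, $Q=Q_{n,r}$, be its primitive dual. There is a toric blow-up of $X_P$ that can be obtained from $X_Q$ by a toric variation of GIT. The reverse holds for their Batyrev--Borisov duals: there is a toric blow-up of $X_{Q^\vee}$ that can be obtained from $X_{P^\vee}$ by a toric variation of GIT.
   Context: Work over $\mathbb{C}$; $k:=n-r$. For a lattice polytope $R$ containing $0$ in its interior, $X_R$ is the toric variety of its spanning fan (cones over faces of $R$), and $R^\vee=\{v:\langle v,w\rangle\ge -1\ \forall w\in R\}$. The Batyrev--Borisov dual of $X_R$ ($R$ reflexive) is $X_{R^\vee}$. The primitive dual of a reflexive polytope $R$ is the polytope $R^\vee$ regarded as a lattice polytope in the sublattice spanned by its own vertices. Definition of $P_{n,r}$: consider the grid with $r$ rows and $k$ columns of unit boxes. The dual quiver has one (internal) vertex per box, one external vertex above the top-left box and one external vertex to the right of the bottom-right box; its arrows go from each internal vertex to the adjacent box to the right and to the adjacent box below, from the upper external vertex to the top-left box, and from the bottom-right box to the right external vertex. Let $M$ be the lattice with basis $e'_v$, $v$ internal, with $e'_v=0$ for external $v$. $P_{n,r}\subset M_{\mathbb R}$ is the polytope with vertices $w_a=-e'_{s(a)}+e'_{t(a)}$ over arrows $a$ of the dual quiver; it is reflexive, and $X_{P_{n,r}}$ is the special fiber of the Gelfand--Cetlin (Gonciulea--Lakshmibai) toric degeneration of $\mathrm{Gr}(n,r)$.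 $Q_{n,r}$ is the primitive dual of $P_{n,r}$. A toric blow-up means a toric variety whose fan is obtained by successively blowing up (star subdividing) the given fan at additional rays. Two toric varieties are related by a toric variation of GIT if they are GIT quotients $\mathbb{C}^m/\!/_{\omega}K$ and $\mathbb{C}^m/\!/_{\omega'}K$ for the same group $K$ and the same weights (i.e. their fans have the same rays), differing only in the stability condition. *)

theory Defs
  imports "HOL-Analysis.Analysis"
begin

section \<open>Lattice polytopes and their duals\<close>

text \<open>
  A lattice polytope is a pair \<open>(\<Lambda>, R)\<close> of a lattice and a polytope in \<open>\<Lambda>\<^sub>\<real>\<close>.  Both \<open>\<Lambda>\<^sub>\<real>\<close> and
  its dual space are the Euclidean space \<^typ>\<open>'a\<close>, with the inner product as the pairing.
\<close>

type_synonym 'a lattice_polytope = "'a set \<times> 'a set"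

definition int_span :: "'a::real_vector set \<Rightarrow> 'a set" where
  "int_span S = {\<Sum>v\<in>T. real_of_int (c v) *\<^sub>R v | T c. finite T \<and> T \<subseteq> S}"

definition dual_lattice :: "'a::euclidean_space set \<Rightarrow> 'a set" where
  "dual_lattice \<Lambda> = {u. \<forall>x\<in>\<Lambda>. u \<bullet> x \<in> \<int>}"

definition polar :: "'a::euclidean_space set \<Rightarrow> 'a set" where
  "polar R = {v. \<forall>w\<in>R. v \<bullet> w \<ge> -1}"

definition dual_polytope :: "'a::euclidean_space lattice_polytope \<Rightarrow> 'a lattice_polytope" where
  "dual_polytope = (\<lambda>(\<Lambda>, R). (dual_lattice \<Lambda>, polar R))"

definition primitive_dual :: "'a::euclidean_space lattice_polytope \<Rightarrow> 'a lattice_polytope" where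
  "primitive_dual = (\<lambda>(\<Lambda>, R). (int_span {v. v extreme_point_of polar R}, polar R))"

section \<open>Toric varieties\<close>

text \<open>
  A toric variety is given by its lattice of one-parameter subgroups and its fan, a set of cones.
\<close>

type_synonym 'a toric_variety = "'a set \<times> 'a set set"

text \<open>
  The empty face, whose cone is \<open>{0}\<close>, counts among the proper faces of the polytope
  (\<open>convex_cone hull {} = {0}\<close>).
\<close>

definition spanning_fan :: "'a::euclidean_space set \<Rightarrow> 'a set set" where
  "spanning_fan R = {convex_cone hull F | F. F face_of R \<and> F \<noteq> R}"

definition toric_variety_of :: "'a::euclidean_space lattice_polytope \<Rightarrow> 'a toric_variety" where
  "toric_variety_of = (\<lambda>(\<Lambda>, R). (\<Lambda>, spanning_fan R))"

definition toric_iso :: "'a::euclidean_space toric_variety \<Rightarrow> 'a toric_variety \<Rightarrow> bool" where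
  "toric_iso X Y \<longleftrightarrow>
     (\<exists>\<phi>. linear \<phi> \<and> bij \<phi> \<and> \<phi> ` fst X = fst Y \<and> (\<lambda>\<sigma>. \<phi> ` \<sigma>) ` snd X = snd Y)"

definition primitive_vector :: "'a::euclidean_space set \<Rightarrow> 'a \<Rightarrow> bool" where
  "primitive_vector \<Lambda> v \<longleftrightarrow> v \<in> \<Lambda> \<and> v \<noteq> 0 \<and> (\<forall>t. 0 < t \<and> t < 1 \<longrightarrow> t *\<^sub>R v \<notin> \<Lambda>)"

definition ray_generators :: "'a::euclidean_space toric_variety \<Rightarrow> 'a set" where
  "ray_generators = (\<lambda>(\<Lambda>, \<Sigma>). {v. primitive_vector \<Lambda> v \<and> convex_cone hull {v} \<in> \<Sigma>})"

section \<open>Toric blow-ups\<close>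

text \<open>
  The star subdivision of a not necessarily simplicial fan: every cone containing \<open>v\<close> is replaced
  by the joins of \<open>v\<close> with those of its faces that do not contain \<open>v\<close>.  In a fan, the faces of
  \<open>\<sigma>\<close> are the cones of the fan contained in \<open>\<sigma>\<close>.
\<close>

definition star_subdivision :: "'a::euclidean_space set set \<Rightarrow> 'a \<Rightarrow> 'a set set" where
  "star_subdivision \<Sigma> v =
     {\<sigma> \<in> \<Sigma>. v \<notin> \<sigma>} \<union>
     {convex_cone hull (insert v \<tau>) | \<tau> \<sigma>. \<tau> \<in> \<Sigma> \<and> \<sigma> \<in> \<Sigma> \<and> v \<notin> \<tau> \<and> v \<in> \<sigma> \<and> \<tau> \<subseteq> \<sigma>}"

inductive toric_blowup :: "'a::euclidean_space toric_variety \<Rightarrow> 'a toric_variety \<Rightarrow> bool"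
  for X where
  refl: "toric_blowup X X"
| step: "toric_blowup X (\<Lambda>, \<Sigma>) \<Longrightarrow> primitive_vector \<Lambda> v \<Longrightarrow> v \<in> \<Union>\<Sigma> \<Longrightarrow>
         v \<notin> ray_generators (\<Lambda>, \<Sigma>) \<Longrightarrow> toric_blowup X (\<Lambda>, star_subdivision \<Sigma> v)"

section \<open>Toric quotients and variation of GIT\<close>

text \<open>
  For a finite set \<open>B\<close> of vectors spanning \<open>\<Lambda>\<^sub>\<real>\<close>, the group \<open>K\<close> is the kernel of the homomorphism
  from \<open>(\<complex>\<^sup>*)\<^sup>B\<close> to the torus \<open>\<Lambda> \<otimes> \<complex>\<^sup>*\<close> that is induced by the inclusion of \<open>B\<close> in \<open>\<Lambda>\<close>.  It acts
  on \<open>\<complex>\<^sup>B\<close> by coordinatewise multiplication, so its weights are the coordinate characters.  The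
  exponents \<open>u \<bullet> b\<close> are integers when \<open>B \<subseteq> \<Lambda>\<close>.
\<close>

definition git_group :: "'a::euclidean_space set \<Rightarrow> 'a set \<Rightarrow> ('a \<Rightarrow> complex) set" where
  "git_group \<Lambda> B = {t \<in> B \<rightarrow>\<^sub>E (UNIV - {0}).
     \<forall>u \<in> dual_lattice \<Lambda>. (\<Prod>b\<in>B. t b powi \<lfloor>u \<bullet> b\<rfloor>) = 1}"

text \<open>
  Every character of \<open>K\<close> is the restriction of a Laurent monomial, so a stability condition is
  given by an exponent vector \<open>\<omega>\<close>, which represents the character \<open>t \<mapsto> \<Prod>b\<in>B. t b powi \<omega> b\<close>.
\<close>

definition git_character :: "'a set \<Rightarrow> ('a \<Rightarrow> int) \<Rightarrow> ('a \<Rightarrow> complex) \<Rightarrow> complex" where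
  "git_character B \<omega> t = (\<Prod>b\<in>B. t b powi \<omega> b)"

definition semi_invariant ::
  "'a::euclidean_space set \<Rightarrow> 'a set \<Rightarrow> ('a \<Rightarrow> int) \<Rightarrow> nat \<Rightarrow> ('a \<Rightarrow> nat) \<Rightarrow> bool" where
  "semi_invariant \<Lambda> B \<omega> d e \<longleftrightarrow>
     (\<forall>t \<in> git_group \<Lambda> B. git_character B (\<lambda>b. int (e b)) t = git_character B \<omega> t ^ d)"

text \<open>
  The quotient \<open>\<complex>\<^sup>B //\<^sub>\<omega> K\<close> is \<open>Proj\<close> of the ring whose degree \<open>d\<close> part is spanned by the monomials
  \<open>x\<^sup>e\<close> of \<open>K\<close>-weight \<open>\<omega>\<^sup>d\<close>.  It is covered by the affine charts \<open>x\<^sup>e \<noteq> 0\<close>, \<open>d > 0\<close>, with coordinate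
  ring \<open>(\<complex>[x][1/x\<^sup>e])\<^sup>K\<close>.  The \<open>K\<close>-invariant Laurent monomials are \<open>\<Prod>b\<in>B. x\<^sub>b powi (u \<bullet> b)\<close> for
  \<open>u\<close> in the dual lattice, and such a monomial lies in this ring iff \<open>u \<bullet> b \<ge> 0\<close> whenever \<open>e b = 0\<close>;
  hence the chart is the affine toric variety of the cone generated by the \<open>b\<close> with \<open>e b = 0\<close>.
\<close>

definition git_quotient ::
  "'a::euclidean_space set \<Rightarrow> 'a set \<Rightarrow> ('a \<Rightarrow> int) \<Rightarrow> 'a toric_variety" where
  "git_quotient \<Lambda> B \<omega> =
     (\<Lambda>, {convex_cone hull {b \<in> B. e b = 0} | e d. d > 0 \<and> semi_invariant \<Lambda> B \<omega> d e})"

text \<open>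
  Fixing \<open>\<Lambda>\<close> and \<open>B\<close> fixes the group and its weights; all elements of \<open>B\<close> are required to be ray
  generators of both quotients.
\<close>

definition toric_VGIT :: "'a::euclidean_space toric_variety \<Rightarrow> 'a toric_variety \<Rightarrow> bool" where
  "toric_VGIT X Y \<longleftrightarrow>
     (\<exists>\<Lambda> B \<omega> \<omega>'. finite B \<and>
        toric_iso X (git_quotient \<Lambda> B \<omega>) \<and> ray_generators (git_quotient \<Lambda> B \<omega>) = B \<and>
        toric_iso Y (git_quotient \<Lambda> B \<omega>') \<and> ray_generators (git_quotient \<Lambda> B \<omega>') = B)"

section \<open>The polytopes $P_{n,r}$ and $Q_{n,r}$\<close>

text \<open>
  \<open>Box i j\<close> is the internal vertex in row \<open>i\<close> (counted from the top) and column \<open>j\<close>; \<open>Upper\<close> and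
  \<open>Rightmost\<close> are the two external vertices.
\<close>

datatype quiver_vertex = Box nat nat | Upper | Rightmost

definition quiver_arrows :: "nat \<Rightarrow> nat \<Rightarrow> (quiver_vertex \<times> quiver_vertex) set" where
  "quiver_arrows n r = (let k = n - r in
     {(Box i j, Box i (j + 1)) | i j. 1 \<le> i \<and> i \<le> r \<and> 1 \<le> j \<and> j < k} \<union>
     {(Box i j, Box (i + 1) j) | i j. 1 \<le> i \<and> i < r \<and> 1 \<le> j \<and> j \<le> k} \<union>
     {(Upper, Box 1 1), (Box r k, Rightmost)})"

text \<open>In the following, \<open>e (i, j)\<close> is the basis vector of the lattice attached to \<open>Box i j\<close>.\<close>

fun vertex_vector :: "(nat \<times> nat \<Rightarrow> 'a::euclidean_space) \<Rightarrow> quiver_vertex \<Rightarrow> 'a" where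
  "vertex_vector e (Box i j) = e (i, j)"
| "vertex_vector e Upper = 0"
| "vertex_vector e Rightmost = 0"

definition P_polytope ::
  "nat \<Rightarrow> nat \<Rightarrow> (nat \<times> nat \<Rightarrow> 'a::euclidean_space) \<Rightarrow> 'a lattice_polytope" where
  "P_polytope n r e =
     (int_span (e ` ({1..r} \<times> {1..n - r})),
      convex hull {- vertex_vector e s + vertex_vector e t | s t. (s, t) \<in> quiver_arrows n r})"

definition Q_polytope ::
  "nat \<Rightarrow> nat \<Rightarrow> (nat \<times> nat \<Rightarrow> 'a::euclidean_space) \<Rightarrow> 'a lattice_polytope" where
  "Q_polytope n r e = primitive_dual (P_polytope n r e)"

end

theory Submission
  imports Defs
begin

text \<open>
  The polar of \<open>P\<close> is, after a shift, \<open>n\<close> times the order polytope of the \<open>r \<times> (n - r)\<close> grid.  Writing \<open>\<rho>\<close> for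
  the vector with \<open>(i, j)\<close>-coordinate \<open>i + j - 1\<close> (the length of a path from \<open>Upper\<close> to \<open>Box i j\<close>),
  its vertices are the vectors \<open>n \<cdot> 1\<^sub>F - \<rho>\<close>, \<open>F\<close> a subset of the grid closed under moving right and
  down.  Intrinsically they are the \<open>y\<close> with \<open>y \<bullet> w \<in> {-1, n - 1}\<close> for all arrow vectors \<open>w\<close>; call
  them filter vectors.  They are primitive in the standard lattice \<open>M\<close>.

  The heart of the matter is a linear automorphism \<open>\<phi>\<close> that maps \<open>M\<close> onto the lattice of \<open>Q\<close> and every
  arrow vector \<open>w\<close> to a filter vector (\<open>dual_embedding\<close>).  To find it, each arrow is assigned a filter,
  in such a way that the sum of the indicator functions of the filters along a path depends on the
  endpoints only and is \<open>\<rho>\<close> for complete paths.  So the rays of \<open>X\<^sub>P\<close> are, up to \<open>\<phi>\<close>, among the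
  rays of \<open>X\<^sub>Q\<close>.  The transpose of \<open>\<phi>\<close> does the same for the duals at no extra cost: the condition
  \<open>\<phi> w \<bullet> w' \<in> {-1, n - 1}\<close> for all arrow vectors \<open>w\<close>, \<open>w'\<close> is symmetric under transposition, so the
  transpose also maps arrow vectors to filter vectors, and since \<open>\<phi> M\<close> is the lattice of \<open>Q\<close>, it maps
  the dual of that lattice onto \<open>M\<close>.

  The rest is general toric geometry (\<open>blowup_related_by_toric_VGIT\<close>).  If the vertices of one polytope
  are among the vertices of another, all of them primitive, then star subdivide the spanning fan of
  the first at the remaining vertices of the second, one after the other.  Spanning fans are complete
  and projective, and star subdivision preserves this.  A projective fan whose rays are spanned by \<open>B\<close>
  is given by heights \<open>\<omega>\<close> on \<open>B\<close>: its cones are spanned by the sets \<open>{b \<in> B. \<omega> b + u \<bullet> b = 0}\<close>, where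
  \<open>u\<close> runs over the polyhedron \<open>\<omega> b + u \<bullet> b \<ge> 0\<close> (\<open>regular_fan\<close>).  With integral heights this fan is the
  GIT quotient of \<open>\<complex>\<^sup>B\<close> with stability condition \<open>\<omega>\<close> (\<open>git_quotient_eq_regular_fan\<close>).  Hence any two
  complete projective fans with the same rays differ by a variation of GIT.
\<close>

section \<open>Fans given by heights\<close>

lemma convex_cone_hull_finite:
  assumes "finite T"
  shows "convex_cone hull T = {\<Sum>b\<in>T. c b *\<^sub>R b | c. \<forall>b\<in>T. 0 \<le> (c b :: real)}" (is "_ = ?R")
proof
  have "T \<subseteq> ?R"
  proof
    fix x assume "x \<in> T"
    then have "(\<Sum>b\<in>T. (if b = x then 1 else 0) *\<^sub>R b) = x"
      using assms by (simp add: if_distrib[of "\<lambda>c. c *\<^sub>R _"] cong: if_cong)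
    then show "x \<in> ?R"
      by (intro CollectI exI[of _ "\<lambda>b. if b = x then 1 else 0"]) auto
  qed
  moreover have "convex_cone ?R"
    unfolding convex_cone_iff
  proof (intro conjI ballI allI impI)
    show "0 \<in> ?R"
      by (intro CollectI exI[of _ "\<lambda>_. 0"]) auto
  next
    fix x y assume "x \<in> ?R" "y \<in> ?R"
    then obtain c d where "x = (\<Sum>b\<in>T. c b *\<^sub>R b)" "\<forall>b\<in>T. 0 \<le> c b"
      "y = (\<Sum>b\<in>T. d b *\<^sub>R b)" "\<forall>b\<in>T. 0 \<le> d b" by auto
    then show "x + y \<in> ?R"
      by (intro CollectI exI[of _ "\<lambda>b. c b + d b"]) (auto simp: scaleR_add_left sum.distrib)
  next
    fix x and t :: real assume "x \<in> ?R" "0 \<le> t"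
    then obtain c where "x = (\<Sum>b\<in>T. c b *\<^sub>R b)" "\<forall>b\<in>T. 0 \<le> c b" by auto
    then show "t *\<^sub>R x \<in> ?R"
      using \<open>0 \<le> t\<close> by (intro CollectI exI[of _ "\<lambda>b. t * c b"]) (auto simp: scaleR_sum_right)
  qed
  ultimately show "convex_cone hull T \<subseteq> ?R"
    by (rule hull_minimal)
  show "?R \<subseteq> convex_cone hull T"
  proof clarify
    fix c :: "'a \<Rightarrow> real" assume c: "\<forall>b\<in>T. 0 \<le> c b"
    have "(\<Sum>b\<in>S. c b *\<^sub>R b) \<in> convex_cone hull T" if "S \<subseteq> T" for S
      using finite_subset[OF that assms] that
      by (induction S rule: finite_induct)
        (simp_all add: convex_cone_hull_contains_0 c convex_cone_hull_add convex_cone_hull_mul hull_inc)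
    then show "(\<Sum>b\<in>T. c b *\<^sub>R b) \<in> convex_cone hull T" by blast
  qed
qed

lemma convex_cone_hull_singleton: "convex_cone hull {b} = {t *\<^sub>R b | t. 0 \<le> t}"
  by (subst convex_cone_hull_finite) (auto intro: exI[of _ "\<lambda>_. _"])

text \<open>
  The polyhedron of \<open>u\<close> such that the linear function \<open>- (u \<bullet> _)\<close> lies below the heights \<open>\<omega>\<close> on \<open>B\<close>.
\<close>

definition feasible :: "'a::euclidean_space set \<Rightarrow> ('a \<Rightarrow> real) \<Rightarrow> 'a set" where
  "feasible B \<omega> = {u. \<forall>b\<in>B. 0 \<le> \<omega> b + u \<bullet> b}"

definition tight :: "'a::euclidean_space set \<Rightarrow> ('a \<Rightarrow> real) \<Rightarrow> 'a \<Rightarrow> 'a set" where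
  "tight B \<omega> u = {b \<in> B. \<omega> b + u \<bullet> b = 0}"

text \<open>
  The normal fan of \<open>feasible B \<omega>\<close>: on the cone of \<open>u\<close>, the largest sublinear function below the
  heights is \<open>- (u \<bullet> _)\<close>.
\<close>

definition regular_fan :: "'a::euclidean_space set \<Rightarrow> ('a \<Rightarrow> real) \<Rightarrow> 'a set set" where
  "regular_fan B \<omega> = (\<lambda>u. convex_cone hull tight B \<omega> u) ` feasible B \<omega>"

text \<open>
  Every \<open>b \<in> B\<close> spans a ray of the regular fan and is the only element of \<open>B\<close> on this ray, and
  \<open>{0}\<close> is a cone of the fan.
\<close>

definition all_rays :: "'a::euclidean_space set \<Rightarrow> ('a \<Rightarrow> real) \<Rightarrow> bool" where
  "all_rays B \<omega> \<longleftrightarrow> (\<exists>u\<in>feasible B \<omega>. tight B \<omega> u = {}) \<and>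
     (\<forall>b\<in>B. \<exists>u\<in>feasible B \<omega>. tight B \<omega> u = {b})"

lemma tight_subset: "tight B \<omega> u \<subseteq> B"
  by (auto simp: tight_def)

text \<open>
  Weak duality and complementary slackness for the linear program that minimises \<open>u \<bullet> v\<close> over the
  feasible \<open>u\<close>: if \<open>v\<close> lies in the cone of some feasible \<open>u0\<close>, then the minimisers are the feasible \<open>u\<close>
  whose cones contain \<open>v\<close>.
\<close>

lemma minimizer_of_mem_cone:
  assumes "finite B" "u0 \<in> feasible B \<omega>" "v \<in> convex_cone hull tight B \<omega> u0" "u \<in> feasible B \<omega>"
  shows "u0 \<bullet> v \<le> u \<bullet> v" "u \<bullet> v = u0 \<bullet> v \<longleftrightarrow> v \<in> convex_cone hull tight B \<omega> u"
proof -
  have fin: "finite (tight B \<omega> w)" for w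
    by (rule finite_subset[OF tight_subset assms(1)])
  have slack: "\<exists>c. (\<forall>b\<in>tight B \<omega> w. 0 \<le> c b) \<and> v = (\<Sum>b\<in>tight B \<omega> w. c b *\<^sub>R b) \<and>
      w' \<bullet> v - w \<bullet> v = (\<Sum>b\<in>tight B \<omega> w. c b * (\<omega> b + w' \<bullet> b))"
    if v: "v \<in> convex_cone hull tight B \<omega> w" for w w'
  proof -
    obtain c where c: "\<forall>b\<in>tight B \<omega> w. 0 \<le> c b" "v = (\<Sum>b\<in>tight B \<omega> w. c b *\<^sub>R b)"
      using v unfolding convex_cone_hull_finite[OF fin] by auto
    have "w \<bullet> v = (\<Sum>b\<in>tight B \<omega> w. - c b * \<omega> b)"
    proof -
      have "w \<bullet> b = - \<omega> b" if "b \<in> tight B \<omega> w" for b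
        using that by (simp add: tight_def)
      then show ?thesis unfolding c(2) inner_sum_right by (simp cong: sum.cong)
    qed
    moreover have "w' \<bullet> v = (\<Sum>b\<in>tight B \<omega> w. c b * (w' \<bullet> b))"
      unfolding c(2) inner_sum_right by simp
    ultimately have "w' \<bullet> v - w \<bullet> v = (\<Sum>b\<in>tight B \<omega> w. c b * (\<omega> b + w' \<bullet> b))"
      by (simp add: sum_subtractf[symmetric] algebra_simps)
    then show ?thesis using c by blast
  qed
  have le: "w \<bullet> v \<le> w' \<bullet> v"
    if that': "v \<in> convex_cone hull tight B \<omega> w" "w' \<in> feasible B \<omega>" for w w'
  proof -
    obtain c where c: "\<forall>b\<in>tight B \<omega> w. 0 \<le> c b"
      "w' \<bullet> v - w \<bullet> v = (\<Sum>b\<in>tight B \<omega> w. c b * (\<omega> b + w' \<bullet> b))"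
      using slack[OF that'(1)] by blast
    have "0 \<le> (\<Sum>b\<in>tight B \<omega> w. c b * (\<omega> b + w' \<bullet> b))"
      using that(2) c(1) by (intro sum_nonneg mult_nonneg_nonneg) (auto simp: feasible_def tight_def)
    then show ?thesis using c by linarith
  qed
  show "u0 \<bullet> v \<le> u \<bullet> v" using le assms by blast
  show "u \<bullet> v = u0 \<bullet> v \<longleftrightarrow> v \<in> convex_cone hull tight B \<omega> u"
  proof
    assume "v \<in> convex_cone hull tight B \<omega> u"
    then show "u \<bullet> v = u0 \<bullet> v" using le assms by (meson order_antisym)
  next
    assume eq: "u \<bullet> v = u0 \<bullet> v"
    obtain c where c: "\<forall>b\<in>tight B \<omega> u0. 0 \<le> c b" "v = (\<Sum>b\<in>tight B \<omega> u0. c b *\<^sub>R b)"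
      "u \<bullet> v - u0 \<bullet> v = (\<Sum>b\<in>tight B \<omega> u0. c b * (\<omega> b + u \<bullet> b))"
      using slack[OF assms(3)] by blast
    \<comment> \<open>A vanishing sum of nonnegative products: positive coefficients occur only at \<open>b\<close> tight for \<open>u\<close>.\<close>
    have "\<forall>b\<in>tight B \<omega> u0. c b * (\<omega> b + u \<bullet> b) = 0"
      using c eq assms(4)
      by (intro sum_nonneg_eq_0_iff[OF fin, THEN iffD1]) (auto simp: feasible_def tight_def)
    then have "c b *\<^sub>R b \<in> convex_cone hull tight B \<omega> u" if "b \<in> tight B \<omega> u0" for b
      using that c(1) tight_subset[of B \<omega> u0]
      by (cases "c b = 0") (auto simp: convex_cone_hull_contains_0 tight_def intro!: convex_cone_hull_mul[OF hull_inc])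
    moreover have "(\<Sum>b\<in>S. c b *\<^sub>R b) \<in> convex_cone hull tight B \<omega> u"
      if "finite S" "\<forall>b\<in>S. c b *\<^sub>R b \<in> convex_cone hull tight B \<omega> u" for S
      using that by (induction S rule: finite_induct)
        (auto simp: convex_cone_hull_contains_0 intro: convex_cone_hull_add)
    ultimately show "v \<in> convex_cone hull tight B \<omega> u"
      unfolding c(2) using fin by blast
  qed
qed

text \<open>
  A cone of the fan contains no element of \<open>B\<close> other than those which define it, because the heights
  are the values of the support function on \<open>B\<close>.
\<close>

lemma tight_mono_of_cone_subset:
  assumes "finite B" "all_rays B \<omega>" "u \<in> feasible B \<omega>"
    and sub: "convex_cone hull tight B \<omega> u1 \<subseteq> convex_cone hull tight B \<omega> u"
  shows "tight B \<omega> u1 \<subseteq> tight B \<omega> u"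
proof
  fix b assume b: "b \<in> tight B \<omega> u1"
  then have "b \<in> B" by (simp add: tight_def)
  then obtain ub where ub: "ub \<in> feasible B \<omega>" "tight B \<omega> ub = {b}"
    using assms(2) by (auto simp: all_rays_def)
  have "b \<in> convex_cone hull tight B \<omega> u"
    using b sub by (meson hull_inc subsetD)
  then have "u \<bullet> b \<le> ub \<bullet> b"
    using minimizer_of_mem_cone(1) assms ub by blast
  moreover have "\<omega> b + ub \<bullet> b = 0" using ub by (auto simp: tight_def)
  moreover have "0 \<le> \<omega> b + u \<bullet> b" using assms(3) \<open>b \<in> B\<close> by (auto simp: feasible_def)
  ultimately show "b \<in> tight B \<omega> u" using \<open>b \<in> B\<close> by (simp add: tight_def)
qed

lemma
  assumes "u1 \<in> feasible B \<omega>" "u2 \<in> feasible B \<omega>" "0 < s" "s < 1"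
  shows segment_feasible: "(1 - s) *\<^sub>R u1 + s *\<^sub>R u2 \<in> feasible B \<omega>"
    and segment_tight: "tight B \<omega> ((1 - s) *\<^sub>R u1 + s *\<^sub>R u2) = tight B \<omega> u1 \<inter> tight B \<omega> u2"
proof -
  have eq: "\<omega> b + ((1 - s) *\<^sub>R u1 + s *\<^sub>R u2) \<bullet> b = (1 - s) * (\<omega> b + u1 \<bullet> b) + s * (\<omega> b + u2 \<bullet> b)" for b
    by (simp add: algebra_simps)
  show "(1 - s) *\<^sub>R u1 + s *\<^sub>R u2 \<in> feasible B \<omega>"
    unfolding feasible_def mem_Collect_eq eq using assms by (auto simp: feasible_def)
  have "(1 - s) * x + s * y = 0 \<longleftrightarrow> x = 0 \<and> y = 0" if "0 \<le> x" "0 \<le> y" for x y :: real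
    using that assms by (subst add_nonneg_eq_0_iff) auto
  then show "tight B \<omega> ((1 - s) *\<^sub>R u1 + s *\<^sub>R u2) = tight B \<omega> u1 \<inter> tight B \<omega> u2"
    unfolding tight_def eq using assms by (auto simp: feasible_def)
qed

lemma closed_feasible: "closed (feasible B \<omega>)"
proof -
  have "feasible B \<omega> = (\<Inter>b\<in>B. {u. 0 \<le> \<omega> b + u \<bullet> b})"
    by (auto simp: feasible_def)
  then show ?thesis
    by (auto intro!: closed_INT closed_Collect_le continuous_intros)
qed

lemma closed_feasible_face: "closed {u \<in> feasible B \<omega>. T \<subseteq> tight B \<omega> u}"
proof -
  have "closed {u. \<forall>b\<in>T. b \<in> B \<and> \<omega> b + u \<bullet> b = 0}"
  proof -
    have "{u. \<forall>b\<in>T. b \<in> B \<and> \<omega> b + u \<bullet> b = 0} = (\<Inter>b\<in>T. {u. b \<in> B \<and> \<omega> b + u \<bullet> b = 0})"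
      by auto
    moreover have "closed {u. b \<in> B \<and> \<omega> b + u \<bullet> b = 0}" for b
      by (cases "b \<in> B") (auto intro!: closed_Collect_eq continuous_intros)
    ultimately show ?thesis by auto
  qed
  moreover have "{u \<in> feasible B \<omega>. T \<subseteq> tight B \<omega> u} =
      feasible B \<omega> \<inter> {u. \<forall>b\<in>T. b \<in> B \<and> \<omega> b + u \<bullet> b = 0}"
    by (auto simp: tight_def)
  ultimately show ?thesis by (simp add: closed_Int closed_feasible)
qed

section \<open>Star subdivision\<close>

text \<open>
  The polyhedron has finitely many faces, so one \<open>g\<close> works for all of them.  Faces on which the
  minimum of \<open>u \<bullet> v\<close> is not attained keep a distance from it, by compactness; and a tight set that
  occurs at a point where \<open>u \<bullet> v\<close> is not minimal also occurs at one where it exceeds the minimum by more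
  than \<open>g\<close>.
\<close>

lemma uniform_gap:
  assumes fin: "finite B" and cpt: "compact (feasible B \<omega>)"
    and u0: "u0 \<in> feasible B \<omega>" "v \<in> convex_cone hull tight B \<omega> u0"
  obtains g where "0 < g"
    and "\<And>u. u \<in> feasible B \<omega> \<Longrightarrow> u0 \<bullet> v < u \<bullet> v \<Longrightarrow>
           \<exists>w\<in>feasible B \<omega>. tight B \<omega> w = tight B \<omega> u \<and> u0 \<bullet> v + g < w \<bullet> v"
    and "\<And>u. u \<in> feasible B \<omega> \<Longrightarrow> u \<bullet> v < u0 \<bullet> v + g \<Longrightarrow>
           \<exists>w\<in>feasible B \<omega>. tight B \<omega> u \<subseteq> tight B \<omega> w \<and> w \<bullet> v = u0 \<bullet> v"
proof -
  define A1 where "A1 T g \<longleftrightarrow> ((\<exists>u\<in>feasible B \<omega>. tight B \<omega> u = T \<and> u0 \<bullet> v < u \<bullet> v) \<longrightarrow>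
     (\<exists>w\<in>feasible B \<omega>. tight B \<omega> w = T \<and> u0 \<bullet> v + g < w \<bullet> v))" for T g
  define A2 where "A2 T g \<longleftrightarrow> (\<forall>u\<in>feasible B \<omega>. tight B \<omega> u = T \<and> u \<bullet> v < u0 \<bullet> v + g \<longrightarrow>
           (\<exists>w\<in>feasible B \<omega>. T \<subseteq> tight B \<omega> w \<and> w \<bullet> v = u0 \<bullet> v))" for T g
  have anti: "A1 T g' \<and> A2 T g'" if "A1 T g \<and> A2 T g" "g' \<le> g" for T g g'
    using that unfolding A1_def A2_def by (meson add_left_mono less_le_trans order_le_less_trans)
  have ex1: "\<exists>g>0. A1 T g" for T
  proof (cases "\<exists>u\<in>feasible B \<omega>. tight B \<omega> u = T \<and> u0 \<bullet> v < u \<bullet> v")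
    case True
    then obtain u where u: "u\<in>feasible B \<omega>" "tight B \<omega> u = T" "u0 \<bullet> v < u \<bullet> v" by blast
    have "A1 T ((u \<bullet> v - u0 \<bullet> v) / 2)"
      unfolding A1_def using u by (intro impI bexI[of _ u]) (auto simp: field_simps)
    then show ?thesis using u(3) by (intro exI[of _ "(u \<bullet> v - u0 \<bullet> v) / 2"]) auto
  next
    case False
    then show ?thesis unfolding A1_def by (intro exI[of _ 1]) auto
  qed
  have ex2: "\<exists>g>0. A2 T g" for T
  proof (cases "{u \<in> feasible B \<omega>. T \<subseteq> tight B \<omega> u} = {}")
    case True
    then show ?thesis unfolding A2_def by (intro exI[of _ 1]) auto
  next
    case False
    have "compact {u \<in> feasible B \<omega>. T \<subseteq> tight B \<omega> u}"
      using closed_feasible_face[of B \<omega> T] cpt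
      by (metis (no_types, lifting) Int_absorb1 compact_Int_closed mem_Collect_eq subsetI)
    then obtain w where w: "w \<in> feasible B \<omega>" "T \<subseteq> tight B \<omega> w"
      and min: "\<forall>u\<in>{u \<in> feasible B \<omega>. T \<subseteq> tight B \<omega> u}. w \<bullet> v \<le> u \<bullet> v"
      using continuous_attains_inf[OF _ False, of "\<lambda>u. u \<bullet> v"] continuous_on_inner[OF continuous_on_id continuous_on_const]
      by auto
    show ?thesis
    proof (cases "w \<bullet> v = u0 \<bullet> v")
      case True
      then show ?thesis using w unfolding A2_def by (intro exI[of _ 1]) auto
    next
      case False
      then have "u0 \<bullet> v < w \<bullet> v"
        using minimizer_of_mem_cone(1)[OF fin u0 w(1)] by linarith
      moreover have "A2 T (w \<bullet> v - u0 \<bullet> v)"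
        unfolding A2_def using min by force
      ultimately show ?thesis by (intro exI[of _ "w \<bullet> v - u0 \<bullet> v"]) auto
    qed
  qed
  have ex: "\<exists>g>0. A1 T g \<and> A2 T g" for T
  proof -
    obtain g1 g2 where g: "g1 > 0" "A1 T g1" "g2 > 0" "A2 T g2" using ex1 ex2 by blast
    have "A1 T (min g1 g2)"
      using g(2) unfolding A1_def by (meson add_left_mono min.cobounded1 order_le_less_trans)
    moreover have "A2 T (min g1 g2)"
      using g(4) unfolding A2_def by (meson add_left_mono min.cobounded2 order_less_le_trans)
    ultimately show ?thesis using g by (intro exI[of _ "min g1 g2"]) auto
  qed
  have "\<exists>g>0. \<forall>T\<in>\<T>. A1 T g \<and> A2 T g" if "finite \<T>" for \<T>
    using that
  proof (induction \<T> rule: finite_induct)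
    case empty
    then show ?case by (intro exI[of _ 1]) auto
  next
    case (insert T \<T>)
    then obtain g where g: "g > 0" "\<forall>T\<in>\<T>. A1 T g \<and> A2 T g" by auto
    obtain h where h: "h > 0" "A1 T h \<and> A2 T h" using ex by blast
    have "A1 S (min g h) \<and> A2 S (min g h)" if "S \<in> insert T \<T>" for S
    proof (cases "S = T")
      case True
      then show ?thesis using anti[of T h "min g h"] h by simp
    next
      case False
      then show ?thesis using anti[of S g "min g h"] g that by simp
    qed
    then show ?case using g(1) h(1) by (intro exI[of _ "min g h"]) simp
  qed
  from this[of "Pow B"] obtain g where g: "g > 0" "\<forall>T\<in>Pow B. A1 T g \<and> A2 T g" using fin by auto
  show thesis
  proof (rule that[OF g(1)])
    fix u assume "u \<in> feasible B \<omega>" "u0 \<bullet> v < u \<bullet> v"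
    then show "\<exists>w\<in>feasible B \<omega>. tight B \<omega> w = tight B \<omega> u \<and> u0 \<bullet> v + g < w \<bullet> v"
      using g(2)[rule_format, of "tight B \<omega> u"] tight_subset[of B \<omega> u] unfolding A1_def by blast
  next
    fix u assume "u \<in> feasible B \<omega>" "u \<bullet> v < u0 \<bullet> v + g"
    then show "\<exists>w\<in>feasible B \<omega>. tight B \<omega> u \<subseteq> tight B \<omega> w \<and> w \<bullet> v = u0 \<bullet> v"
      using g(2)[rule_format, of "tight B \<omega> u"] tight_subset[of B \<omega> u] unfolding A2_def by blast
  qed
qed

lemma convex_cone_hull_insert_hull:
  "convex_cone hull (insert v (convex_cone hull T)) = convex_cone hull (insert v T)"
  by (rule hull_insert[symmetric])

text \<open>
  Giving \<open>v\<close> a height slightly below the value of the support function at \<open>v\<close> cuts off the face of the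
  polyhedron whose normal cone contains \<open>v\<close>.  If the cut is shallow, then the new facet meets exactly
  the faces that touch the removed face without being contained in it; in the normal fan this is the
  star subdivision.  The height is chosen rational to have integral heights in the end.
\<close>

lemma star_subdivision_regular_fan:
  assumes fin: "finite B" and cpt: "compact (feasible B \<omega>)" and rays: "all_rays B \<omega>"
    and v: "v \<notin> B" "v \<in> \<Union>(regular_fan B \<omega>)" "v \<noteq> 0" "\<And>b. b \<in> B \<Longrightarrow> v \<notin> convex_cone hull {b}"
  obtains q :: real where "q \<in> \<rat>"
    "star_subdivision (regular_fan B \<omega>) v = regular_fan (insert v B) (fun_upd \<omega> v q)"
    "all_rays (insert v B) (fun_upd \<omega> v q)" "compact (feasible (insert v B) (fun_upd \<omega> v q))"
proof -
  obtain u0 where u0: "u0 \<in> feasible B \<omega>" "v \<in> convex_cone hull tight B \<omega> u0"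
    using v(2) by (auto simp: regular_fan_def)
  obtain g where g: "0 < g"
    and away: "\<And>u. u \<in> feasible B \<omega> \<Longrightarrow> u0 \<bullet> v < u \<bullet> v \<Longrightarrow>
           \<exists>w\<in>feasible B \<omega>. tight B \<omega> w = tight B \<omega> u \<and> u0 \<bullet> v + g < w \<bullet> v"
    and near: "\<And>u. u \<in> feasible B \<omega> \<Longrightarrow> u \<bullet> v < u0 \<bullet> v + g \<Longrightarrow>
           \<exists>w\<in>feasible B \<omega>. tight B \<omega> u \<subseteq> tight B \<omega> w \<and> w \<bullet> v = u0 \<bullet> v"
    using uniform_gap[OF fin cpt u0] by metis
  obtain q where q: "q \<in> \<rat>" "- (u0 \<bullet> v) - g < q" "q < - (u0 \<bullet> v)"
    using Rats_dense_in_real[of "- (u0 \<bullet> v) - g" "- (u0 \<bullet> v)"] g by auto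
  let ?B = "insert v B" and ?\<omega> = "fun_upd \<omega> v q"
  have feas: "u \<in> feasible ?B ?\<omega> \<longleftrightarrow> u \<in> feasible B \<omega> \<and> 0 \<le> q + u \<bullet> v" for u
    using v(1) by (auto simp: feasible_def)
  have tight: "tight ?B ?\<omega> u = (if q + u \<bullet> v = 0 then insert v (tight B \<omega> u) else tight B \<omega> u)" for u
    using v(1) by (auto simp: tight_def)
  have in_cone: "v \<in> convex_cone hull tight B \<omega> u \<longleftrightarrow> u \<bullet> v = u0 \<bullet> v" if "u \<in> feasible B \<omega>" for u
    using minimizer_of_mem_cone(2)[OF fin u0 that] by simp
  have min: "u0 \<bullet> v \<le> u \<bullet> v" if "u \<in> feasible B \<omega>" for u
    using minimizer_of_mem_cone(1)[OF fin u0 that] by simp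
  \<comment> \<open>Old faces that avoid \<open>v\<close> can be exposed strictly inside the new half space.\<close>
  have old: "\<exists>w\<in>feasible ?B ?\<omega>. tight ?B ?\<omega> w = tight B \<omega> u"
    if u: "u \<in> feasible B \<omega>" "v \<notin> convex_cone hull tight B \<omega> u" for u
  proof -
    have "u0 \<bullet> v < u \<bullet> v" using in_cone min u by (metis order_le_less)
    then obtain w where w: "w\<in>feasible B \<omega>" "tight B \<omega> w = tight B \<omega> u" "u0 \<bullet> v + g < w \<bullet> v"
      using away u by blast
    then show ?thesis using q by (intro bexI[of _ w]) (auto simp: feas tight)
  qed
  \<comment> \<open>New faces are exposed where the segment from \<open>u1\<close> to \<open>u2\<close> meets the new hyperplane.\<close>
  have new: "\<exists>w\<in>feasible ?B ?\<omega>. tight ?B ?\<omega> w = insert v (tight B \<omega> u1)"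
    if u: "u1 \<in> feasible B \<omega>" "v \<notin> convex_cone hull tight B \<omega> u1"
      "u2 \<in> feasible B \<omega>" "v \<in> convex_cone hull tight B \<omega> u2" "tight B \<omega> u1 \<subseteq> tight B \<omega> u2" for u1 u2
  proof -
    have "u0 \<bullet> v < u1 \<bullet> v" using in_cone min u by (metis order_le_less)
    then obtain w where w: "w\<in>feasible B \<omega>" "tight B \<omega> w = tight B \<omega> u1" "u0 \<bullet> v + g < w \<bullet> v"
      using away u by blast
    have u2: "u2 \<bullet> v = u0 \<bullet> v" using in_cone u by blast
    define s where "s = (w \<bullet> v + q) / (w \<bullet> v - u0 \<bullet> v)"
    have s: "0 < s" "s < 1"
      unfolding s_def using w(3) q g by (auto simp: field_simps)
    define z where "z = (1 - s) *\<^sub>R w + s *\<^sub>R u2"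
    have "z \<bullet> v = w \<bullet> v - s * (w \<bullet> v - u0 \<bullet> v)"
      unfolding z_def using u2 by (simp add: algebra_simps)
    also have "\<dots> = - q"
      using w(3) g unfolding s_def by simp
    finally have "q + z \<bullet> v = 0" by simp
    moreover have "z \<in> feasible B \<omega>"
      unfolding z_def using segment_feasible w(1) u(3) s by blast
    moreover have "tight B \<omega> z = tight B \<omega> u1"
      unfolding z_def using segment_tight[OF w(1) u(3) s] w(2) u(5) by auto
    ultimately show ?thesis by (intro bexI[of _ z]) (auto simp: feas tight)
  qed
  have "star_subdivision (regular_fan B \<omega>) v = regular_fan ?B ?\<omega>"
  proof
    show "star_subdivision (regular_fan B \<omega>) v \<subseteq> regular_fan ?B ?\<omega>"
    proof
      fix \<sigma> assume "\<sigma> \<in> star_subdivision (regular_fan B \<omega>) v"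
      then consider "\<sigma> \<in> regular_fan B \<omega>" "v \<notin> \<sigma>" |
        \<tau> \<sigma>' where "\<sigma> = convex_cone hull (insert v \<tau>)" "\<tau> \<in> regular_fan B \<omega>" "\<sigma>' \<in> regular_fan B \<omega>"
          "v \<notin> \<tau>" "v \<in> \<sigma>'" "\<tau> \<subseteq> \<sigma>'"
        unfolding star_subdivision_def by blast
      then show "\<sigma> \<in> regular_fan ?B ?\<omega>"
      proof cases
        case 1
        then obtain u where u: "u \<in> feasible B \<omega>" "\<sigma> = convex_cone hull tight B \<omega> u"
          by (auto simp: regular_fan_def)
        then obtain w where "w\<in>feasible ?B ?\<omega>" "tight ?B ?\<omega> w = tight B \<omega> u"
          using old[OF u(1)] 1(2) by blast
        then show ?thesis unfolding u(2) regular_fan_def by (metis image_eqI)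
      next
        case 2
        then obtain u1 u2 where u: "u1 \<in> feasible B \<omega>" "\<tau> = convex_cone hull tight B \<omega> u1"
          "u2 \<in> feasible B \<omega>" "\<sigma>' = convex_cone hull tight B \<omega> u2"
          by (auto simp: regular_fan_def)
        have "tight B \<omega> u1 \<subseteq> tight B \<omega> u2"
          using tight_mono_of_cone_subset[OF fin rays] u 2 by blast
        then obtain w where "w\<in>feasible ?B ?\<omega>" "tight ?B ?\<omega> w = insert v (tight B \<omega> u1)"
          using new u 2 by blast
        then show ?thesis
          unfolding 2 u(2) convex_cone_hull_insert_hull regular_fan_def by (metis image_eqI)
      qed
    qed
    show "regular_fan ?B ?\<omega> \<subseteq> star_subdivision (regular_fan B \<omega>) v"
    proof
      fix \<sigma> assume "\<sigma> \<in> regular_fan ?B ?\<omega>"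
      then obtain u where u: "u \<in> feasible ?B ?\<omega>" "\<sigma> = convex_cone hull tight ?B ?\<omega> u"
        by (auto simp: regular_fan_def)
      have uB: "u \<in> feasible B \<omega>" and "0 \<le> q + u \<bullet> v" using u feas by auto
      then have out: "v \<notin> convex_cone hull tight B \<omega> u"
        using in_cone q by auto
      show "\<sigma> \<in> star_subdivision (regular_fan B \<omega>) v"
      proof (cases "q + u \<bullet> v = 0")
        case True
        obtain w where w: "w \<in> feasible B \<omega>" "tight B \<omega> u \<subseteq> tight B \<omega> w" "w \<bullet> v = u0 \<bullet> v"
          using near[OF uB] q True by auto
        have "\<sigma> = convex_cone hull (insert v (convex_cone hull tight B \<omega> u))"
          unfolding convex_cone_hull_insert_hull u(2) tight using True by simp
        moreover have "convex_cone hull tight B \<omega> u \<subseteq> convex_cone hull tight B \<omega> w"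
          using w(2) by (rule hull_mono)
        moreover have "v \<in> convex_cone hull tight B \<omega> w" using w in_cone by blast
        moreover have "convex_cone hull tight B \<omega> u \<in> regular_fan B \<omega>"
          "convex_cone hull tight B \<omega> w \<in> regular_fan B \<omega>"
          using uB w(1) by (auto simp: regular_fan_def)
        ultimately show ?thesis
          using out unfolding star_subdivision_def by blast
      next
        case False
        then show ?thesis
          using u(2) out uB unfolding star_subdivision_def tight by (auto simp: regular_fan_def)
      qed
    qed
  qed
  moreover have "all_rays ?B ?\<omega>"
    unfolding all_rays_def
  proof (intro conjI ballI)
    obtain u1 where u1: "u1 \<in> feasible B \<omega>" "tight B \<omega> u1 = {}"
      using rays by (auto simp: all_rays_def)
    have out: "v \<notin> convex_cone hull tight B \<omega> u1" using u1 v(3) by simp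
    show "\<exists>u\<in>feasible ?B ?\<omega>. tight ?B ?\<omega> u = {}"
      using old[OF u1(1) out] u1(2) by simp
    fix b assume "b \<in> ?B"
    then consider "b = v" | "b \<in> B" by blast
    then show "\<exists>u\<in>feasible ?B ?\<omega>. tight ?B ?\<omega> u = {b}"
    proof cases
      case 1
      then show ?thesis using new[OF u1(1) out u0] u1(2) by simp
    next
      case 2
      then obtain u where u: "u \<in> feasible B \<omega>" "tight B \<omega> u = {b}"
        using rays by (auto simp: all_rays_def)
      then show ?thesis using old[OF u(1)] v(4)[OF 2] by simp
    qed
  qed
  moreover have "compact (feasible ?B ?\<omega>)"
  proof -
    have "feasible ?B ?\<omega> = feasible B \<omega> \<inter> feasible ?B ?\<omega>" using feas by blast
    then show ?thesis using cpt closed_feasible by (metis compact_Int_closed)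
  qed
  ultimately show thesis using that q(1) by blast
qed

lemma uniform_small_multiple:
  fixes s c :: "'b \<Rightarrow> real"
  assumes "finite B" "\<And>b. b \<in> B \<Longrightarrow> 0 < s b"
  obtains \<delta> where "0 < \<delta>" "\<And>b. b \<in> B \<Longrightarrow> \<delta> * c b < s b"
proof -
  have "eventually (\<lambda>\<delta>. \<delta> * c b < s b) (at_right 0)" if "b \<in> B" for b
  proof -
    have "((\<lambda>\<delta>. \<delta> * c b) \<longlongrightarrow> 0 * c b) (at_right 0)"
      by (intro tendsto_intros)
    then show ?thesis using assms(2)[OF that] order_tendstoD(2) by fastforce
  qed
  then have "eventually (\<lambda>\<delta>. \<forall>b\<in>B. \<delta> * c b < s b) (at_right 0)"
    using assms(1) by (simp add: eventually_ball_finite)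
  then have "eventually (\<lambda>\<delta>. 0 < \<delta> \<and> (\<forall>b\<in>B. \<delta> * c b < s b)) (at_right (0::real))"
    by (intro eventually_conj eventually_at_right_less)
  then show thesis
    using that eventually_happens'[OF trivial_limit_at_right_real] by blast
qed

section \<open>Completeness\<close>

text \<open>
  Strong duality: if \<open>u\<close> minimises \<open>u \<bullet> v\<close> and \<open>v\<close> is not in the cone of \<open>u\<close>, then a hyperplane that
  separates \<open>v\<close> from this cone gives a feasible direction along which \<open>u \<bullet> v\<close> decreases.
\<close>

lemma regular_fan_complete:
  assumes fin: "finite B" and cpt: "compact (feasible B \<omega>)" and ne: "feasible B \<omega> \<noteq> {}"
  shows "\<Union>(regular_fan B \<omega>) = UNIV"
proof (intro equalityI subset_UNIV subsetI)
  fix v :: 'a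
  obtain u where u: "u \<in> feasible B \<omega>" and min: "\<forall>w\<in>feasible B \<omega>. u \<bullet> v \<le> w \<bullet> v"
    using continuous_attains_inf[OF cpt ne, of "\<lambda>u. u \<bullet> v"] continuous_on_inner[OF continuous_on_id continuous_on_const]
    by auto
  let ?C = "convex_cone hull tight B \<omega> u"
  have "v \<in> ?C"
  proof (rule ccontr)
    assume "v \<notin> ?C"
    moreover have "closed ?C"
      using finite_subset[OF tight_subset fin] by (rule closed_convex_cone_hull)
    ultimately obtain a \<beta> where a: "a \<bullet> v < \<beta>" "\<forall>x\<in>?C. \<beta> < a \<bullet> x"
      using separating_hyperplane_closed_point[OF convex_convex_cone_hull] by blast
    have \<beta>: "\<beta> < 0" using a(2) convex_cone_hull_contains_0 by force
    have pos: "0 \<le> a \<bullet> x" if x: "x \<in> ?C" for x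
    proof (rule ccontr)
      assume neg: "\<not> 0 \<le> a \<bullet> x"
      have "(\<beta> / (a \<bullet> x)) *\<^sub>R x \<in> ?C"
        using x neg \<beta> by (intro convex_cone_hull_mul divide_nonpos_nonpos) auto
      then have "\<beta> < a \<bullet> ((\<beta> / (a \<bullet> x)) *\<^sub>R x)" using a(2) by blast
      then show False using neg by simp
    qed
    obtain \<delta> where \<delta>: "0 < \<delta>"
      "\<And>b. b \<in> B - tight B \<omega> u \<Longrightarrow> \<delta> * (- (a \<bullet> b)) < \<omega> b + u \<bullet> b"
    proof (rule uniform_small_multiple[of "B - tight B \<omega> u" "\<lambda>b. \<omega> b + u \<bullet> b" "\<lambda>b. - (a \<bullet> b)"])
      show "finite (B - tight B \<omega> u)" using fin by simp
      show "0 < \<omega> b + u \<bullet> b" if "b \<in> B - tight B \<omega> u" for b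
        using that u by (force simp: feasible_def tight_def)
    qed (use that in blast)
    have "u + \<delta> *\<^sub>R a \<in> feasible B \<omega>"
      unfolding feasible_def mem_Collect_eq
    proof
      fix b assume b: "b \<in> B"
      show "0 \<le> \<omega> b + (u + \<delta> *\<^sub>R a) \<bullet> b"
      proof (cases "b \<in> tight B \<omega> u")
        case True
        then have "0 \<le> \<delta> * (a \<bullet> b)" using pos \<delta>(1) by (simp add: hull_inc)
        then show ?thesis using True by (simp add: tight_def algebra_simps)
      next
        case False
        then show ?thesis using \<delta>(2)[of b] b by (simp add: algebra_simps)
      qed
    qed
    then have "u \<bullet> v \<le> (u + \<delta> *\<^sub>R a) \<bullet> v" using min by blast
    moreover have "\<delta> * (a \<bullet> v) < 0" using a(1) \<beta> \<delta>(1) by (simp add: mult_pos_neg)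
    ultimately show False by (simp add: algebra_simps)
  qed
  then show "v \<in> \<Union>(regular_fan B \<omega>)" using u by (auto simp: regular_fan_def)
qed

text \<open>
  Feasible \<open>u\<close> are bounded below on \<open>convex hull B\<close>, which contains a ball around \<open>0\<close>.
\<close>

lemma compact_feasible:
  assumes fin: "finite B" and int: "0 \<in> interior (convex hull B)"
  shows "compact (feasible B \<omega>)"
proof -
  obtain d where d: "0 < d" "cball 0 d \<subseteq> convex hull B"
    using int by (auto simp: mem_interior_cball)
  define M where "M = (\<Sum>b\<in>B. \<bar>\<omega> b\<bar>)"
  have "norm u \<le> M / d" if u: "u \<in> feasible B \<omega>" for u
  proof (cases "u = 0")
    case False
    have "b \<in> {x. - M \<le> u \<bullet> x}" if "b \<in> B" for b
    proof -
      have "\<bar>\<omega> b\<bar> \<le> M" unfolding M_def using fin that by (intro member_le_sum) auto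
      then show ?thesis using u that by (force simp: feasible_def)
    qed
    then have "convex hull B \<subseteq> {x. - M \<le> u \<bullet> x}"
      by (intro hull_minimal) (auto simp: convex_halfspace_ge)
    moreover have "(- d / norm u) *\<^sub>R u \<in> convex hull B"
      using d False by (intro subsetD[OF d(2)]) (simp add: dist_norm)
    ultimately have "- M \<le> u \<bullet> ((- d / norm u) *\<^sub>R u)" by blast
    then have "d * norm u \<le> M"
      using False by (simp add: dot_square_norm power2_eq_square)
    then show ?thesis using d(1) by (simp add: field_simps)
  qed (use d(1) in \<open>simp add: M_def sum_nonneg\<close>)
  then have "bounded (feasible B \<omega>)" by (auto simp: bounded_iff)
  then show ?thesis using closed_feasible compact_eq_bounded_closed by blast
qed

section \<open>Spanning fans\<close>

lemma polytope_eq_hull_extreme_points: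
  fixes R :: "'a::euclidean_space set"
  assumes "polytope R"
  shows "finite {v. v extreme_point_of R}" "R = convex hull {v. v extreme_point_of R}"
  using assms finite_polyhedron_extreme_points polytope_imp_polyhedron
    Krein_Milman_Minkowski polytope_imp_compact polytope_imp_convex by blast+

lemma convex_cone_hull_convex_hull_eq: "convex_cone hull (convex hull S) = convex_cone hull S"
proof
  show "convex_cone hull (convex hull S) \<subseteq> convex_cone hull S"
    by (intro hull_minimal convex_hull_subset_convex_cone_hull convex_cone_convex_cone_hull)
  show "convex_cone hull S \<subseteq> convex_cone hull (convex hull S)"
    by (intro hull_mono hull_subset)
qed

lemma convex_cone_hull_face:
  fixes R :: "'a::euclidean_space set"
  assumes "polytope R" "F face_of R"
  shows "convex_cone hull F = convex_cone hull {v. v extreme_point_of R \<and> v \<in> F}"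
proof -
  have "F = convex hull {v. v extreme_point_of F}"
    using assms polytope_eq_hull_extreme_points(2) face_of_polytope_polytope by blast
  also have "{v. v extreme_point_of F} = {v. v extreme_point_of R \<and> v \<in> F}"
    using extreme_point_of_face[OF assms(2)] by blast
  finally show ?thesis
    using convex_cone_hull_convex_hull_eq by metis
qed

text \<open>
  A proper face is exposed, and as \<open>0\<close> is an interior point, the value of the linear function on the
  face can be normalised.  For the empty face \<open>u = 0\<close> does it.
\<close>

lemma proper_face_at_height_one:
  fixes R :: "'a::euclidean_space set"
  assumes R: "polytope R" "0 \<in> interior R" and F: "F face_of R" "F \<noteq> R"
  obtains u where "\<And>x. x \<in> R \<Longrightarrow> 0 \<le> 1 + u \<bullet> x" "F = {x \<in> R. 1 + u \<bullet> x = 0}"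
proof (cases "F = {}")
  case True
  then show thesis using that[of 0] by simp
next
  case False
  have "F exposed_face_of R"
    using F(1) R(1) exposed_face_of_polyhedron polytope_imp_polyhedron by blast
  then obtain a \<beta> where a: "R \<subseteq> {x. a \<bullet> x \<le> \<beta>}" "F = R \<inter> {x. a \<bullet> x = \<beta>}"
    by (auto simp: exposed_face_of_def)
  obtain d where d: "0 < d" "cball 0 d \<subseteq> R"
    using R(2) by (auto simp: mem_interior_cball)
  have a0: "a \<noteq> 0"
  proof
    assume "a = 0"
    then have "\<beta> = 0" using a(2) False by auto
    then show False using a F(2) \<open>a = 0\<close> by auto
  qed
  have "(d / norm a) *\<^sub>R a \<in> R"
    using d a0 by (intro subsetD[OF d(2)]) (simp add: dist_norm)
  then have "d * norm a \<le> \<beta>"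
    using a(1) a0 by (auto simp: dot_square_norm power2_eq_square)
  then have \<beta>: "0 < \<beta>" using d a0 by (meson less_le_trans mult_pos_pos zero_less_norm_iff)
  show thesis
  proof
    show "0 \<le> 1 + (- a /\<^sub>R \<beta>) \<bullet> x" if "x \<in> R" for x
      using a(1) that \<beta> by (auto simp: field_simps)
    show "F = {x \<in> R. 1 + (- a /\<^sub>R \<beta>) \<bullet> x = 0}"
      using a(2) \<beta> by (auto simp: field_simps)
  qed
qed

lemma feasible_extreme_points:
  fixes R :: "'a::euclidean_space set"
  assumes "polytope R"
  shows "feasible {v. v extreme_point_of R} (\<lambda>_. 1) = {u. \<forall>x\<in>R. 0 \<le> 1 + u \<bullet> x}"
proof (intro equalityI subsetI CollectI ballI)
  fix u x assume u: "u \<in> feasible {v. v extreme_point_of R} (\<lambda>_. 1)" and "x \<in> R"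
  have "{v. v extreme_point_of R} \<subseteq> {x. - 1 \<le> u \<bullet> x}"
    using u by (auto simp: feasible_def)
  then have "convex hull {v. v extreme_point_of R} \<subseteq> {x. - 1 \<le> u \<bullet> x}"
    by (intro hull_minimal) (auto simp: convex_halfspace_ge)
  then show "0 \<le> 1 + u \<bullet> x"
    using \<open>x \<in> R\<close> polytope_eq_hull_extreme_points(2)[OF assms] by auto
qed (auto simp: feasible_def extreme_point_of_def)

lemma spanning_fan_eq_regular_fan:
  fixes R :: "'a::euclidean_space set"
  assumes R: "polytope R" "0 \<in> interior R"
  shows "spanning_fan R = regular_fan {v. v extreme_point_of R} (\<lambda>_. 1)"
proof
  let ?B = "{v. v extreme_point_of R}"
  have tight: "tight ?B (\<lambda>_. 1) u = {v. v extreme_point_of R \<and> v \<in> {x \<in> R. 1 + u \<bullet> x = 0}}" for u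
    by (auto simp: tight_def extreme_point_of_def)
  show "spanning_fan R \<subseteq> regular_fan ?B (\<lambda>_. 1)"
  proof
    fix \<sigma> assume "\<sigma> \<in> spanning_fan R"
    then obtain F where F: "\<sigma> = convex_cone hull F" "F face_of R" "F \<noteq> R"
      by (auto simp: spanning_fan_def)
    obtain u where u: "\<And>x. x \<in> R \<Longrightarrow> 0 \<le> 1 + u \<bullet> x" "F = {x \<in> R. 1 + u \<bullet> x = 0}"
      using proper_face_at_height_one[OF R F(2,3)] by metis
    have "\<sigma> = convex_cone hull tight ?B (\<lambda>_. 1) u"
      unfolding F(1) tight u(2)[symmetric] by (rule convex_cone_hull_face[OF R(1) F(2)])
    then show "\<sigma> \<in> regular_fan ?B (\<lambda>_. 1)"
      using u(1) unfolding regular_fan_def feasible_extreme_points[OF R(1)] by blast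
  qed
  show "regular_fan ?B (\<lambda>_. 1) \<subseteq> spanning_fan R"
  proof
    fix \<sigma> assume "\<sigma> \<in> regular_fan ?B (\<lambda>_. 1)"
    then obtain u where u: "\<forall>x\<in>R. 0 \<le> 1 + u \<bullet> x" "\<sigma> = convex_cone hull tight ?B (\<lambda>_. 1) u"
      unfolding regular_fan_def feasible_extreme_points[OF R(1)] by blast
    let ?F = "R \<inter> {x. u \<bullet> x = - 1}"
    have face: "?F face_of R"
      using u(1) by (intro face_of_Int_supporting_hyperplane_ge polytope_imp_convex R(1)) force
    have "{x \<in> R. 1 + u \<bullet> x = 0} = ?F" by force
    then have "\<sigma> = convex_cone hull ?F"
      unfolding u(2) tight convex_cone_hull_face[OF R(1) face] by simp
    moreover have "0 \<in> R" using R(2) interior_subset by blast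
    then have "?F \<noteq> R" by force
    ultimately show "\<sigma> \<in> spanning_fan R" using face by (auto simp: spanning_fan_def)
  qed
qed

lemma all_rays_extreme_points:
  fixes R :: "'a::euclidean_space set"
  assumes R: "polytope R" "0 \<in> interior R"
  shows "all_rays {v. v extreme_point_of R} (\<lambda>_. 1)"
  unfolding all_rays_def
proof (intro conjI ballI)
  let ?B = "{v. v extreme_point_of R}"
  show "\<exists>u\<in>feasible ?B (\<lambda>_. 1). tight ?B (\<lambda>_. 1) u = {}"
    by (intro bexI[of _ 0]) (auto simp: feasible_def tight_def)
  fix b assume "b \<in> ?B"
  then have face: "{b} face_of R" by (simp add: face_of_singleton)
  moreover have "{b} \<noteq> R" using R(2) by auto
  ultimately obtain u where u: "\<And>x. x \<in> R \<Longrightarrow> 0 \<le> 1 + u \<bullet> x" "{b} = {x \<in> R. 1 + u \<bullet> x = 0}"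
    using proper_face_at_height_one[OF R] by metis
  have "tight ?B (\<lambda>_. 1) u = ?B \<inter> {b}"
    unfolding u(2) by (auto simp: tight_def extreme_point_of_def)
  then show "\<exists>u\<in>feasible ?B (\<lambda>_. 1). tight ?B (\<lambda>_. 1) u = {b}"
    using u(1) \<open>b \<in> ?B\<close> unfolding feasible_extreme_points[OF R(1)] by (intro bexI[of _ u]) auto
qed

section \<open>Rays and blow-ups of regular fans\<close>

lemma primitive_vectors_on_same_ray:
  assumes "primitive_vector \<Lambda> v" "primitive_vector \<Lambda> b" "v \<in> convex_cone hull {b}"
  shows "v = b"
proof -
  obtain t where t: "0 \<le> t" "v = t *\<^sub>R b"
    using assms(3) by (auto simp: convex_cone_hull_singleton)
  then have pos: "0 < t" using assms(1) by (cases "t = 0") (auto simp: primitive_vector_def)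
  then have b: "b = (1 / t) *\<^sub>R v" using t by simp
  have "\<not> t < 1" using assms(1,2) t pos unfolding primitive_vector_def by blast
  moreover have "\<not> 1 / t < 1"
    using assms(1,2) pos b unfolding primitive_vector_def by (metis divide_pos_pos zero_less_one)
  ultimately have "t = 1" using pos by (simp add: field_simps)
  then show ?thesis using t by simp
qed

lemma ray_generators_regular_fan:
  assumes "all_rays B \<omega>" and prim: "\<And>b. b \<in> B \<Longrightarrow> primitive_vector \<Lambda> b"
  shows "ray_generators (\<Lambda>, regular_fan B \<omega>) = B"
proof
  show "ray_generators (\<Lambda>, regular_fan B \<omega>) \<subseteq> B"
  proof
    fix v assume "v \<in> ray_generators (\<Lambda>, regular_fan B \<omega>)"
    then obtain u where v: "primitive_vector \<Lambda> v"
      and u: "convex_cone hull {v} = convex_cone hull tight B \<omega> u"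
      by (auto simp: ray_generators_def regular_fan_def)
    have "tight B \<omega> u \<noteq> {}"
    proof
      assume "tight B \<omega> u = {}"
      then have "v \<in> {0}" using u by (metis convex_cone_hull_empty hull_inc singletonI)
      then show False using v by (simp add: primitive_vector_def)
    qed
    then obtain b where b: "b \<in> tight B \<omega> u" by blast
    then have "b \<in> B" "b \<in> convex_cone hull {v}"
      using u by (auto simp: hull_inc tight_def)
    then show "v \<in> B" using primitive_vectors_on_same_ray[OF prim v] by blast
  qed
  show "B \<subseteq> ray_generators (\<Lambda>, regular_fan B \<omega>)"
  proof
    fix b assume b: "b \<in> B"
    then obtain u where u: "u \<in> feasible B \<omega>" "tight B \<omega> u = {b}"
      using assms(1) by (auto simp: all_rays_def)
    then have "convex_cone hull {b} \<in> regular_fan B \<omega>"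
      unfolding regular_fan_def by (metis image_eqI)
    then show "b \<in> ray_generators (\<Lambda>, regular_fan B \<omega>)"
      using prim[OF b] by (simp add: ray_generators_def)
  qed
qed

text \<open>
  Completeness guarantees that each further vector lies in the support of the fan, and primitivity that
  it does not lie on an existing ray.
\<close>

lemma toric_blowup_regular_fan:
  assumes "finite D" "finite B" "D \<inter> B = {}" "all_rays B \<omega>" "compact (feasible B \<omega>)"
    and rat: "\<And>b. b \<in> B \<Longrightarrow> \<omega> b \<in> \<rat>" and prim: "\<And>b. b \<in> B \<union> D \<Longrightarrow> primitive_vector \<Lambda> b"
  shows "\<exists>\<omega>'. toric_blowup (\<Lambda>, regular_fan B \<omega>) (\<Lambda>, regular_fan (B \<union> D) \<omega>') \<and>
    all_rays (B \<union> D) \<omega>' \<and> compact (feasible (B \<union> D) \<omega>') \<and> (\<forall>b\<in>B \<union> D. \<omega>' b \<in> \<rat>)"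
  using assms(1,3) prim
proof (induction D rule: finite_induct)
  case empty
  then show ?case using assms by (intro exI[of _ \<omega>]) (auto intro: toric_blowup.refl)
next
  case (insert v D)
  let ?B = "B \<union> D"
  obtain \<omega>' where IH: "toric_blowup (\<Lambda>, regular_fan B \<omega>) (\<Lambda>, regular_fan ?B \<omega>')"
    "all_rays ?B \<omega>'" "compact (feasible ?B \<omega>')" "\<forall>b\<in>?B. \<omega>' b \<in> \<rat>"
    using insert by auto
  have fin: "finite ?B" using insert(1) assms(2) by simp
  have v: "v \<notin> ?B" using insert by auto
  have primv: "primitive_vector \<Lambda> v" and primB: "\<And>b. b \<in> ?B \<Longrightarrow> primitive_vector \<Lambda> b"
    using insert.prems by auto
  have ne: "feasible ?B \<omega>' \<noteq> {}" using IH(2) by (auto simp: all_rays_def)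
  have sup: "v \<in> \<Union>(regular_fan ?B \<omega>')"
    using regular_fan_complete[OF fin IH(3) ne] by blast
  have out: "v \<notin> convex_cone hull {b}" if "b \<in> ?B" for b
    using primitive_vectors_on_same_ray[OF primv primB[OF that]] v that by blast
  have "v \<noteq> 0" using primv by (simp add: primitive_vector_def)
  then obtain q where q: "q \<in> \<rat>"
    "star_subdivision (regular_fan ?B \<omega>') v = regular_fan (insert v ?B) (fun_upd \<omega>' v q)"
    "all_rays (insert v ?B) (fun_upd \<omega>' v q)" "compact (feasible (insert v ?B) (fun_upd \<omega>' v q))"
    using star_subdivision_regular_fan[OF fin IH(3,2) v sup _ out] by blast
  have "toric_blowup (\<Lambda>, regular_fan B \<omega>) (\<Lambda>, regular_fan (insert v ?B) (fun_upd \<omega>' v q))"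
    unfolding q(2)[symmetric]
    using IH(1) primv sup v ray_generators_regular_fan[OF IH(2) primB]
    by (intro toric_blowup.step) auto
  moreover have "\<forall>b\<in>insert v ?B. fun_upd \<omega>' v q b \<in> \<rat>"
    using q(1) IH(4) by simp
  ultimately show ?case
    using q(3,4) unfolding Un_insert_right by blast
qed

section \<open>Integral spans and dual lattices\<close>

lemma int_spanI:
  "finite T \<Longrightarrow> T \<subseteq> S \<Longrightarrow> x = (\<Sum>v\<in>T. real_of_int (c v) *\<^sub>R v) \<Longrightarrow> x \<in> int_span S"
  by (auto simp: int_span_def)

lemma int_span_base: "x \<in> S \<Longrightarrow> x \<in> int_span S"
  by (rule int_spanI[of "{x}" _ _ "\<lambda>_. 1"]) auto

lemma int_span_0: "0 \<in> int_span S"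
  by (rule int_spanI[of "{}"]) auto

lemma int_span_add:
  assumes "x \<in> int_span S" "y \<in> int_span S"
  shows "x + y \<in> int_span S"
proof -
  obtain T c T' c' where T: "finite T" "T \<subseteq> S" "x = (\<Sum>v\<in>T. real_of_int (c v) *\<^sub>R v)"
    and T': "finite T'" "T' \<subseteq> S" "y = (\<Sum>v\<in>T'. real_of_int (c' v) *\<^sub>R v)"
    using assms by (auto simp: int_span_def)
  have "x = (\<Sum>v\<in>T \<union> T'. real_of_int (if v \<in> T then c v else 0) *\<^sub>R v)"
    unfolding T(3) using T(1) T'(1) by (intro sum.mono_neutral_cong_left) auto
  moreover have "y = (\<Sum>v\<in>T \<union> T'. real_of_int (if v \<in> T' then c' v else 0) *\<^sub>R v)"
    unfolding T'(3) using T(1) T'(1) by (intro sum.mono_neutral_cong_left) auto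
  ultimately have eq: "x + y = (\<Sum>v\<in>T \<union> T'. real_of_int ((if v \<in> T then c v else 0) + (if v \<in> T' then c' v else 0)) *\<^sub>R v)"
    by (simp add: sum.distrib scaleR_add_left)
  show ?thesis by (rule int_spanI[OF _ _ eq]) (use T(1,2) T'(1,2) in auto)
qed

lemma int_span_scale:
  assumes "x \<in> int_span S"
  shows "real_of_int m *\<^sub>R x \<in> int_span S"
proof -
  obtain T c where T: "finite T" "T \<subseteq> S" "x = (\<Sum>v\<in>T. real_of_int (c v) *\<^sub>R v)"
    using assms by (auto simp: int_span_def)
  have eq: "real_of_int m *\<^sub>R x = (\<Sum>v\<in>T. real_of_int (m * c v) *\<^sub>R v)"
    unfolding T(3) by (simp add: scaleR_sum_right)
  show ?thesis by (rule int_spanI[OF T(1,2) eq])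
qed

lemma int_span_diff:
  assumes "x \<in> int_span S" "y \<in> int_span S"
  shows "x - y \<in> int_span S"
  using int_span_add[OF assms(1) int_span_scale[OF assms(2), of "-1"]] by simp

lemma int_span_sum: "(\<And>a. a \<in> A \<Longrightarrow> f a \<in> int_span S) \<Longrightarrow> sum f A \<in> int_span S"
  by (induction A rule: infinite_finite_induct) (simp_all add: int_span_0 int_span_add)

lemma int_span_subset: "S \<subseteq> int_span S' \<Longrightarrow> int_span S \<subseteq> int_span S'"
  unfolding int_span_def[of S] by (auto intro!: int_span_sum int_span_scale)

lemma int_span_linear_image:
  assumes "linear f"
  shows "int_span (f ` S) = f ` int_span S"
proof
  show "f ` int_span S \<subseteq> int_span (f ` S)"
  proof clarify
    fix x assume "x \<in> int_span S"
    then obtain T c where T: "T \<subseteq> S" "x = (\<Sum>v\<in>T. real_of_int (c v) *\<^sub>R v)"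
      by (auto simp: int_span_def)
    have "f x = (\<Sum>v\<in>T. real_of_int (c v) *\<^sub>R f v)"
      unfolding T(2) by (simp add: linear_sum[OF assms] linear_cmul[OF assms])
    also have "\<dots> \<in> int_span (f ` S)"
      using T(1) by (intro int_span_sum int_span_scale int_span_base) auto
    finally show "f x \<in> int_span (f ` S)" .
  qed
  show "int_span (f ` S) \<subseteq> f ` int_span S"
  proof
    fix y assume "y \<in> int_span (f ` S)"
    then obtain T c where T: "T \<subseteq> f ` S" "y = (\<Sum>w\<in>T. real_of_int (c w) *\<^sub>R w)"
      by (auto simp: int_span_def)
    have "\<forall>w\<in>T. \<exists>v. v \<in> S \<and> f v = w" using T(1) by blast
    then obtain g where g: "\<forall>w\<in>T. g w \<in> S \<and> f (g w) = w" by (rule bchoice[THEN exE])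
    have "y = f (\<Sum>w\<in>T. real_of_int (c w) *\<^sub>R g w)"
      unfolding T(2) by (simp add: linear_sum[OF assms] linear_cmul[OF assms] g)
    moreover have "(\<Sum>w\<in>T. real_of_int (c w) *\<^sub>R g w) \<in> int_span S"
      using g by (intro int_span_sum int_span_scale int_span_base) blast
    ultimately show "y \<in> f ` int_span S" by blast
  qed
qed

lemma dual_lattice_int_span: "dual_lattice (int_span G) = {u. \<forall>g\<in>G. u \<bullet> g \<in> \<int>}"
proof (intro equalityI subsetI CollectI ballI)
  fix u g assume "u \<in> dual_lattice (int_span G)" "g \<in> G"
  then show "u \<bullet> g \<in> \<int>" using int_span_base by (auto simp: dual_lattice_def)
next
  fix u assume u: "u \<in> {u. \<forall>g\<in>G. u \<bullet> g \<in> \<int>}"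
  have "u \<bullet> x \<in> \<int>" if x: "x \<in> int_span G" for x
  proof -
    obtain T c where T: "T \<subseteq> G" "x = (\<Sum>v\<in>T. real_of_int (c v) *\<^sub>R v)"
      using x by (auto simp: int_span_def)
    have "u \<bullet> x = (\<Sum>v\<in>T. real_of_int (c v) * (u \<bullet> v))"
      unfolding T(2) by (simp add: inner_sum_right)
    also have "\<dots> \<in> \<int>"
      using u T(1) by (intro Ints_sum Ints_mult) auto
    finally show ?thesis .
  qed
  then show "u \<in> dual_lattice (int_span G)" by (simp add: dual_lattice_def)
qed

lemma int_span_Basis: "int_span (Basis :: 'a::euclidean_space set) = {x. \<forall>b\<in>Basis. x \<bullet> b \<in> \<int>}"
proof (intro equalityI subsetI CollectI ballI)
  fix x b :: 'a assume x: "x \<in> int_span Basis" and b: "b \<in> Basis"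
  have "b \<in> dual_lattice (int_span Basis)"
    unfolding dual_lattice_int_span using b by (auto simp: inner_Basis)
  then show "x \<bullet> b \<in> \<int>" using x by (auto simp: dual_lattice_def inner_commute)
next
  fix x :: 'a assume x: "x \<in> {x. \<forall>b\<in>Basis. x \<bullet> b \<in> \<int>}"
  have "x = (\<Sum>b\<in>Basis. (x \<bullet> b) *\<^sub>R b)" by (simp add: euclidean_representation)
  also have "\<dots> = (\<Sum>b\<in>Basis. real_of_int \<lfloor>x \<bullet> b\<rfloor> *\<^sub>R b)"
  proof (rule sum.cong[OF HOL.refl])
    fix b :: 'a assume "b \<in> Basis"
    then have "x \<bullet> b \<in> \<int>" using x by blast
    then show "(x \<bullet> b) *\<^sub>R b = real_of_int \<lfloor>x \<bullet> b\<rfloor> *\<^sub>R b" by (metis Ints_cases floor_of_int)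
  qed
  finally show "x \<in> int_span Basis" by (intro int_spanI[of Basis]) auto
qed

lemma dual_lattice_Basis: "dual_lattice (int_span (Basis :: 'a::euclidean_space set)) = int_span Basis"
  by (simp only: dual_lattice_int_span) (simp add: int_span_Basis)

section \<open>Rational points of faces\<close>

text \<open>
  \<open>C\<close> is linearly independent also over the rationals, and it has as many elements as \<open>G\<close>; so by the
  exchange lemma for rational vector spaces every \<open>g \<in> G\<close> is a rational combination of \<open>C\<close>.
\<close>

lemma rational_on_lattice_if_rational_on_basis:
  fixes G C :: "'a::euclidean_space set"
  assumes fin: "finite G" and C: "independent C" "C \<subseteq> int_span G" "card C = card G"
    and rat: "\<And>c. c \<in> C \<Longrightarrow> u \<bullet> c \<in> \<rat>" and g: "g \<in> G"
  shows "u \<bullet> g \<in> \<rat>"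
proof -
  interpret Q: vector_space "\<lambda>(q::rat) (x::'a). real_of_rat q *\<^sub>R x"
    by unfold_locales (simp_all add: algebra_simps of_rat_add of_rat_mult)
  have "int_span G \<subseteq> Q.span G"
  proof
    fix x assume "x \<in> int_span G"
    then obtain T c where T: "T \<subseteq> G" "x = (\<Sum>v\<in>T. real_of_int (c v) *\<^sub>R v)"
      by (auto simp: int_span_def)
    have "x = (\<Sum>v\<in>T. real_of_rat (rat_of_int (c v)) *\<^sub>R v)" using T(2) by simp
    also have "\<dots> \<in> Q.span G"
      using T(1) by (intro Q.span_sum Q.span_scale Q.span_base) auto
    finally show "x \<in> Q.span G" .
  qed
  then have CG: "C \<subseteq> Q.span G" using C(2) by blast
  have finC: "finite C" using C(1) independent_imp_finite by blast
  have indep: "Q.independent C"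
  proof
    assume "Q.dependent C"
    then obtain t q v where t: "finite t" "t \<subseteq> C" "(\<Sum>v\<in>t. real_of_rat (q v) *\<^sub>R v) = 0" "v \<in> t" "q v \<noteq> 0"
      unfolding Q.dependent_explicit by blast
    then have "dependent C"
      unfolding dependent_explicit by (intro exI[of _ t] conjI exI[of _ "\<lambda>v. real_of_rat (q v)"]) auto
    then show False using C(1) by simp
  qed
  have "g \<in> Q.span C"
  proof (rule ccontr)
    assume notin: "g \<notin> Q.span C"
    then have "Q.independent (insert g C)" "g \<notin> C"
      using indep Q.independent_insert Q.span_base by auto
    moreover have "insert g C \<subseteq> Q.span G" using CG g Q.span_base by blast
    ultimately have "card (insert g C) \<le> card G"
      using Q.independent_span_bound[OF fin] by blast
    then show False using \<open>g \<notin> C\<close> finC C(3) by simp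
  qed
  moreover have "Q.subspace {x. u \<bullet> x \<in> \<rat>}"
    unfolding Q.subspace_def by (auto simp: inner_add_right)
  ultimately show ?thesis
    using Q.span_induct[of g C "\<lambda>x. u \<bullet> x \<in> \<rat>"] rat by blast
qed

lemma linear_functional_eq_inner:
  fixes f :: "'a::euclidean_space \<Rightarrow> real"
  assumes "linear f"
  obtains u where "\<And>x. f x = u \<bullet> x"
  using adjoint_works[OF assms, of _ 1] that[of "adjoint f 1"] by (simp add: inner_commute)

lemma ex_dual_basis:
  fixes C :: "'a::euclidean_space set"
  assumes "independent C"
  obtains d where "\<And>b c. b \<in> C \<Longrightarrow> c \<in> C \<Longrightarrow> d b \<bullet> c = (if b = c then 1 else 0)"
proof -
  have "\<exists>u. \<forall>c\<in>C. u \<bullet> c = (if b = c then 1 else 0)" for b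
  proof -
    obtain f :: "'a \<Rightarrow> real" where f: "linear f" "\<forall>c\<in>C. f c = (if b = c then 1 else 0)"
      using linear_independent_extend[OF assms, of "\<lambda>c. if b = c then 1 else (0::real)"] by blast
    obtain u where "\<And>x. f x = u \<bullet> x" using linear_functional_eq_inner[OF f(1)] by blast
    then show ?thesis using f(2) by metis
  qed
  then obtain d where "\<And>b c. c \<in> C \<Longrightarrow> d b \<bullet> c = (if b = c then 1 else 0)" by metis
  then show thesis using that by blast
qed

text \<open>
  Rational points are dense in a face whose equations are rational.  To see this, extend a maximal
  independent subset of the tight vectors to a basis \<open>C\<close> of lattice vectors and move the values of \<open>u\<close>
  on the rest of \<open>C\<close> to nearby rational numbers.
\<close>

lemma rational_point_of_regular_fan:
  fixes G B :: "'a::euclidean_space set"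
  assumes G: "independent G" "span G = UNIV" and B: "finite B" "B \<subseteq> int_span G"
    and rat: "\<And>b. b \<in> B \<Longrightarrow> \<omega> b \<in> \<rat>" and u: "u \<in> feasible B \<omega>"
  obtains w where "w \<in> feasible B \<omega>" "tight B \<omega> w = tight B \<omega> u" "\<And>g. g \<in> G \<Longrightarrow> w \<bullet> g \<in> \<rat>"
proof -
  obtain T where T: "T \<subseteq> tight B \<omega> u" "independent T" "tight B \<omega> u \<subseteq> span T"
    using maximal_independent_subset by blast
  have "T \<subseteq> int_span G" using T(1) tight_subset B(2) by blast
  then obtain C where C: "T \<subseteq> C" "C \<subseteq> int_span G" "independent C" "int_span G \<subseteq> span C"
    using maximal_independent_subset_extend[OF _ T(2)] by metis
  have spanC: "span C = UNIV"
    using C(4) int_span_base G(2) by (metis span_minimal subset_UNIV subspace_span subset_antisym subsetI subset_trans)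
  have finC: "finite C" using C(3) independent_imp_finite by blast
  have "card C = card G"
    using spanC G C(3) by (metis dim_span_eq_card_independent)
  obtain d where d: "\<And>b c. b \<in> C \<Longrightarrow> c \<in> C \<Longrightarrow> d b \<bullet> c = (if b = c then 1 else 0)"
    using ex_dual_basis[OF C(3)] by blast
  have expand: "w \<bullet> x = (\<Sum>c\<in>C. (w \<bullet> c) * (d c \<bullet> x))" for w x
  proof -
    have "linear (\<lambda>x. \<Sum>c\<in>C. (w \<bullet> c) * (d c \<bullet> x))"
      by (intro linear_compose_sum ballI linear_compose_scale_right linear_compose_scale linearI)
        (auto simp: algebra_simps)
    moreover have "linear (\<lambda>x. w \<bullet> x)" by (intro linearI) (auto simp: algebra_simps)
    moreover have "w \<bullet> b = (\<Sum>c\<in>C. (w \<bullet> c) * (d c \<bullet> b))" if "b \<in> C" for b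
      using that d finC by (simp add: if_distrib[of "\<lambda>z. _ * z"] cong: if_cong sum.cong)
    ultimately show ?thesis
      using linear_eq_on_span[of "\<lambda>x. w \<bullet> x" "\<lambda>x. \<Sum>c\<in>C. (w \<bullet> c) * (d c \<bullet> x)" C x] spanC by blast
  qed
  define N where "N x = (\<Sum>c\<in>C. \<bar>d c \<bullet> x\<bar>)" for x
  obtain \<eta> where \<eta>: "0 < \<eta>" "\<And>b. b \<in> B - tight B \<omega> u \<Longrightarrow> \<eta> * N b < \<omega> b + u \<bullet> b"
  proof (rule uniform_small_multiple[of "B - tight B \<omega> u" "\<lambda>b. \<omega> b + u \<bullet> b" N])
    show "finite (B - tight B \<omega> u)" using B(1) by simp
    show "0 < \<omega> b + u \<bullet> b" if "b \<in> B - tight B \<omega> u" for b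
      using that u by (force simp: feasible_def tight_def)
  qed (use that in blast)
  have uT: "u \<bullet> c \<in> \<rat>" if "c \<in> tight B \<omega> u" for c
  proof -
    have "u \<bullet> c = - \<omega> c" "c \<in> B" using that by (auto simp: tight_def)
    then show ?thesis using rat by simp
  qed
  have "\<exists>r\<in>\<rat>. \<bar>r - u \<bullet> c\<bar> \<le> \<eta> \<and> (c \<in> T \<longrightarrow> r = u \<bullet> c)" for c
  proof (cases "c \<in> T")
    case True
    then show ?thesis using uT T(1) \<eta>(1) by (intro bexI[of _ "u \<bullet> c"]) auto
  next
    case False
    obtain r where "r \<in> \<rat>" "u \<bullet> c < r" "r < u \<bullet> c + \<eta>"
      using Rats_dense_in_real[of "u \<bullet> c" "u \<bullet> c + \<eta>"] \<eta>(1) by auto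
    then show ?thesis using False by (intro bexI[of _ r]) auto
  qed
  then obtain r where r: "\<And>c. r c \<in> \<rat>" "\<And>c. \<bar>r c - u \<bullet> c\<bar> \<le> \<eta>" "\<And>c. c \<in> T \<Longrightarrow> r c = u \<bullet> c"
    by metis
  define w where "w = (\<Sum>c\<in>C. r c *\<^sub>R d c)"
  have wC: "w \<bullet> c = r c" if "c \<in> C" for c
    using that d finC unfolding w_def
    by (simp add: inner_sum_left if_distrib[of "\<lambda>z. _ * z"] cong: if_cong sum.cong)
  have wT: "w \<bullet> b = u \<bullet> b" if b: "b \<in> tight B \<omega> u" for b
  proof -
    have "linear (\<lambda>x. w \<bullet> x)" "linear (\<lambda>x. u \<bullet> x)"
      by (intro linearI; simp add: algebra_simps)+
    then show ?thesis
      using linear_eq_on_span[of "\<lambda>x. w \<bullet> x" "\<lambda>x. u \<bullet> x" T b] wC r(3) C(1) T(3) b by (metis subsetD)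
  qed
  have dev: "\<bar>w \<bullet> x - u \<bullet> x\<bar> \<le> \<eta> * N x" for x
  proof -
    have "\<bar>w \<bullet> x - u \<bullet> x\<bar> = \<bar>\<Sum>c\<in>C. (w \<bullet> c - u \<bullet> c) * (d c \<bullet> x)\<bar>"
      unfolding expand[of w x] expand[of u x] by (simp add: sum_subtractf left_diff_distrib)
    also have "\<dots> \<le> (\<Sum>c\<in>C. \<eta> * \<bar>d c \<bullet> x\<bar>)"
      using r(2) wC by (intro order_trans[OF sum_abs] sum_mono) (auto simp: abs_mult intro!: mult_right_mono)
    finally show ?thesis by (simp add: N_def sum_distrib_left)
  qed
  have slack: "0 < \<omega> b + w \<bullet> b" if "b \<in> B - tight B \<omega> u" for b
    using \<eta>(2)[OF that] dev[of b] by linarith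
  have zero: "\<omega> b + w \<bullet> b = 0" if "b \<in> tight B \<omega> u" for b
    using wT[OF that] that by (simp add: tight_def)
  show thesis
  proof
    show "w \<in> feasible B \<omega>"
      unfolding feasible_def mem_Collect_eq
    proof
      fix b assume "b \<in> B"
      then show "0 \<le> \<omega> b + w \<bullet> b"
        using slack[of b] zero[of b] by (cases "b \<in> tight B \<omega> u") auto
    qed
    have "\<omega> b + w \<bullet> b = 0 \<longleftrightarrow> b \<in> tight B \<omega> u" if "b \<in> B" for b
      using slack[of b] zero[of b] that by (cases "b \<in> tight B \<omega> u") auto
    then show "tight B \<omega> w = tight B \<omega> u"
      using tight_subset[of B \<omega> u] unfolding tight_def[of B \<omega> w] by blast
    show "w \<bullet> g \<in> \<rat>" if "g \<in> G" for g
      using rational_on_lattice_if_rational_on_basis[OF _ C(3,2) \<open>card C = card G\<close> _ that, of w]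
        independent_imp_finite[OF G(1)] wC r(1) by simp
  qed
qed

lemma common_denominator:
  fixes f :: "'b \<Rightarrow> real"
  assumes "finite S" "\<And>x. x \<in> S \<Longrightarrow> f x \<in> \<rat>"
  obtains D :: nat where "0 < D" "\<And>x. x \<in> S \<Longrightarrow> real D * f x \<in> \<int>"
proof -
  have "\<exists>D::nat. 0 < D \<and> (\<forall>x\<in>S. real D * f x \<in> \<int>)"
    using assms
  proof (induction S rule: finite_induct)
    case empty
    then show ?case by auto
  next
    case (insert a S)
    then obtain D :: nat where D: "0 < D" "\<forall>x\<in>S. real D * f x \<in> \<int>" by auto
    have "f a \<in> \<rat>" using insert by simp
    then obtain i :: int and m :: nat where m: "m \<noteq> 0" "f a = real_of_int i / real m"
      unfolding Rats_eq_int_div_nat by blast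
    have "real (D * m) * f a = real_of_int (int D * i)" using m by simp
    moreover have "real (D * m) * f x = real_of_int (int m) * (real D * f x)" for x by simp
    ultimately have "\<forall>x\<in>insert a S. real (D * m) * f x \<in> \<int>"
      using D(2) by (metis Ints_mult Ints_of_int insert_iff)
    then show ?case using D(1) m(1) by (intro exI[of _ "D * m"]) auto
  qed
  then show thesis using that by blast
qed

section \<open>GIT quotients\<close>

text \<open>
  The values \<open>m\<close> on a maximal independent subset of \<open>B\<close> determine a linear functional, and the relations
  that express the other elements of \<open>B\<close> force the remaining values.
\<close>

lemma functional_vanishing_on_relations:
  fixes B :: "'a::euclidean_space set" and m :: "'a \<Rightarrow> real"
  assumes fin: "finite B"
    and rel: "\<And>\<theta>. (\<Sum>b\<in>B. \<theta> b *\<^sub>R b) = 0 \<Longrightarrow> (\<Sum>b\<in>B. \<theta> b * m b) = 0"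
  obtains u where "\<And>b. b \<in> B \<Longrightarrow> m b = u \<bullet> b"
proof -
  obtain T where T: "T \<subseteq> B" "independent T" "B \<subseteq> span T"
    using maximal_independent_subset by blast
  have finT: "finite T" using T(1) fin finite_subset by blast
  obtain f :: "'a \<Rightarrow> real" where f: "linear f" "\<forall>c\<in>T. f c = m c"
    using linear_independent_extend[OF T(2), of m] by blast
  obtain u where u: "\<And>x. f x = u \<bullet> x" using linear_functional_eq_inner[OF f(1)] by blast
  have "m b = u \<bullet> b" if b: "b \<in> B" for b
  proof -
    obtain c where c: "b = (\<Sum>a\<in>T. c a *\<^sub>R a)"
      using T(3) b span_finite[OF finT] by auto
    define \<theta> where "\<theta> a = (if a = b then 1 else 0) - (if a \<in> T then c a else 0)" for a
    have T': "B \<inter> {a. a \<in> T} = T" using T(1) by blast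
    have "(\<Sum>a\<in>B. \<theta> a *\<^sub>R a) = (\<Sum>a\<in>B. (if a = b then a else 0)) - (\<Sum>a\<in>B. if a \<in> T then c a *\<^sub>R a else 0)"
      unfolding \<theta>_def sum_subtractf[symmetric] by (intro sum.cong HOL.refl) (auto simp: algebra_simps)
    also have "\<dots> = b - (\<Sum>a\<in>T. c a *\<^sub>R a)"
      using fin b T' by (simp add: sum.If_cases)
    finally have "(\<Sum>a\<in>B. \<theta> a * m a) = 0" using c rel by simp
    moreover have "(\<Sum>a\<in>B. \<theta> a * m a) = (\<Sum>a\<in>B. (if a = b then m a else 0)) - (\<Sum>a\<in>B. if a \<in> T then c a * m a else 0)"
      unfolding \<theta>_def sum_subtractf[symmetric] by (intro sum.cong HOL.refl) (auto simp: algebra_simps)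
    ultimately have "m b = (\<Sum>a\<in>T. c a * m a)"
      using fin b T' by (simp add: sum.If_cases)
    also have "\<dots> = (\<Sum>a\<in>T. c a * (u \<bullet> a))"
      using f(2) u by (intro sum.cong HOL.refl) metis
    also have "\<dots> = u \<bullet> b" by (subst c) (simp add: inner_sum_right)
    finally show ?thesis .
  qed
  then show thesis using that by blast
qed

lemma floor_inner_dual_lattice:
  assumes "u \<in> dual_lattice \<Lambda>" "b \<in> \<Lambda>"
  shows "real_of_int \<lfloor>u \<bullet> b\<rfloor> = u \<bullet> b"
proof -
  have "u \<bullet> b \<in> \<int>" using assms by (simp add: dual_lattice_def)
  then show ?thesis by (metis Ints_cases floor_of_int)
qed

text \<open>
  Here the group enters only through its connected component: each linear relation
  \<open>\<Sum>b\<in>B. \<theta> b *\<^sub>R b = 0\<close> gives the element \<open>b \<mapsto> exp (\<theta> b)\<close> of the group.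
\<close>

lemma semi_invariant_imp_linear:
  fixes B :: "'a::euclidean_space set"
  assumes fin: "finite B" and B: "B \<subseteq> \<Lambda>" and inv: "semi_invariant \<Lambda> B \<omega> d e"
  obtains u where "\<And>b. b \<in> B \<Longrightarrow> real (e b) = real d * real_of_int (\<omega> b) + u \<bullet> b"
proof -
  have rel: "(\<Sum>b\<in>B. \<theta> b * (real (e b) - real d * real_of_int (\<omega> b))) = 0"
    if \<theta>: "(\<Sum>b\<in>B. \<theta> b *\<^sub>R b) = 0" for \<theta>
  proof -
    define t where "t = restrict (\<lambda>b. complex_of_real (exp (\<theta> b))) B"
    have prod: "(\<Prod>b\<in>B. t b powi k b) = complex_of_real (exp (\<Sum>b\<in>B. \<theta> b * real_of_int (k b)))" for k
    proof -
      have "(\<Prod>b\<in>B. t b powi k b) = (\<Prod>b\<in>B. complex_of_real (exp (\<theta> b * real_of_int (k b))))"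
      proof (rule prod.cong[OF HOL.refl])
        fix b assume "b \<in> B"
        moreover have "complex_of_real (exp x) powi i = complex_of_real (exp (x * real_of_int i))" for x i
          by (metis exp_power_int mult.commute of_real_power_int)
        ultimately show "t b powi k b = complex_of_real (exp (\<theta> b * real_of_int (k b)))"
          by (simp add: t_def)
      qed
      then show ?thesis using fin by (simp add: exp_sum)
    qed
    have "t \<in> git_group \<Lambda> B"
      unfolding git_group_def mem_Collect_eq
    proof (intro conjI ballI)
      show "t \<in> B \<rightarrow>\<^sub>E UNIV - {0}" by (auto simp: t_def)
      fix u assume u: "u \<in> dual_lattice \<Lambda>"
      have "(\<Sum>b\<in>B. \<theta> b * real_of_int \<lfloor>u \<bullet> b\<rfloor>) = (\<Sum>b\<in>B. \<theta> b * (u \<bullet> b))"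
        using floor_inner_dual_lattice[OF u] B by (intro sum.cong HOL.refl) auto
      also have "\<dots> = u \<bullet> (\<Sum>b\<in>B. \<theta> b *\<^sub>R b)" by (simp add: inner_sum_right)
      finally show "(\<Prod>b\<in>B. t b powi \<lfloor>u \<bullet> b\<rfloor>) = 1" unfolding prod by (simp add: \<theta>)
    qed
    then have "git_character B (\<lambda>b. int (e b)) t = git_character B \<omega> t ^ d"
      using inv by (simp add: semi_invariant_def)
    then have "complex_of_real (exp (\<Sum>b\<in>B. \<theta> b * real (e b))) =
        complex_of_real (exp (real d * (\<Sum>b\<in>B. \<theta> b * real_of_int (\<omega> b))))"
      unfolding git_character_def prod by (simp add: exp_of_nat_mult)
    then have "(\<Sum>b\<in>B. \<theta> b * real (e b)) = real d * (\<Sum>b\<in>B. \<theta> b * real_of_int (\<omega> b))"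
      by (simp only: of_real_eq_iff exp_inj_iff)
    then show ?thesis
      by (simp add: algebra_simps sum_subtractf sum_distrib_left)
  qed
  obtain u where "\<And>b. b \<in> B \<Longrightarrow> real (e b) - real d * real_of_int (\<omega> b) = u \<bullet> b"
    using functional_vanishing_on_relations[OF fin rel] by blast
  then show thesis using that[of u] by (simp add: algebra_simps)
qed

lemma linear_imp_semi_invariant:
  fixes B :: "'a::euclidean_space set"
  assumes "finite B" "u \<in> dual_lattice \<Lambda>" "B \<subseteq> \<Lambda>"
    and e: "\<And>b. b \<in> B \<Longrightarrow> real (e b) = real d * real_of_int (\<omega> b) + u \<bullet> b"
  shows "semi_invariant \<Lambda> B \<omega> d e"
  unfolding semi_invariant_def
proof
  fix t assume t: "t \<in> git_group \<Lambda> B"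
  have "int (e b) = int d * \<omega> b + \<lfloor>u \<bullet> b\<rfloor>" if "b \<in> B" for b
  proof -
    have "real_of_int \<lfloor>u \<bullet> b\<rfloor> = u \<bullet> b"
      using floor_inner_dual_lattice assms(2,3) that by blast
    then have "real d * real_of_int (\<omega> b) + real_of_int \<lfloor>u \<bullet> b\<rfloor> = real (e b)"
      using e[OF that] by linarith
    then have "real_of_int (int (e b)) = real_of_int (int d * \<omega> b + \<lfloor>u \<bullet> b\<rfloor>)"
      unfolding of_int_add of_int_mult of_int_of_nat_eq by (rule sym)
    then show ?thesis by (simp only: of_int_eq_iff)
  qed
  then have "git_character B (\<lambda>b. int (e b)) t = (\<Prod>b\<in>B. (t b powi \<omega> b) ^ d * t b powi \<lfloor>u \<bullet> b\<rfloor>)"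
    unfolding git_character_def
  proof (intro prod.cong HOL.refl)
    fix b assume b: "b \<in> B"
    then have "t b \<noteq> 0" using t by (auto simp: git_group_def PiE_def Pi_def)
    moreover assume "\<And>b. b \<in> B \<Longrightarrow> int (e b) = int d * \<omega> b + \<lfloor>u \<bullet> b\<rfloor>"
    ultimately show "t b powi int (e b) = (t b powi \<omega> b) ^ d * t b powi \<lfloor>u \<bullet> b\<rfloor>"
      using b by (simp add: power_int_add mult.commute[of "int d"] power_int_mult)
  qed
  also have "\<dots> = git_character B \<omega> t ^ d * (\<Prod>b\<in>B. t b powi \<lfloor>u \<bullet> b\<rfloor>)"
    by (simp add: git_character_def prod.distrib prod_power_distrib)
  also have "\<dots> = git_character B \<omega> t ^ d"
    using t assms(2) by (simp add: git_group_def)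
  finally show "git_character B (\<lambda>b. int (e b)) t = git_character B \<omega> t ^ d" .
qed

text \<open>
  A monomial of weight \<open>\<omega>\<^sup>d\<close> has exponents \<open>e b = d (\<omega> b + u \<bullet> b)\<close> for a feasible \<open>u\<close>, and
  \<open>e b = 0\<close> means that \<open>b\<close> is tight.  Conversely, every tight set occurs for a rational \<open>u\<close>, and a common
  denominator serves as \<open>d\<close>.
\<close>

lemma git_quotient_eq_regular_fan:
  fixes B :: "'a::euclidean_space set"
  assumes G: "independent G" "span G = UNIV" and B: "finite B" "B \<subseteq> int_span G"
  shows "git_quotient (int_span G) B \<omega> = (int_span G, regular_fan B (\<lambda>b. real_of_int (\<omega> b)))"
proof -
  let ?\<omega> = "\<lambda>b. real_of_int (\<omega> b)"
  have "{convex_cone hull {b \<in> B. e b = 0} | e d. d > 0 \<and> semi_invariant (int_span G) B \<omega> d e}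
     = regular_fan B ?\<omega>"
  proof
    show "{convex_cone hull {b \<in> B. e b = 0} | e d. d > 0 \<and> semi_invariant (int_span G) B \<omega> d e}
        \<subseteq> regular_fan B ?\<omega>"
    proof clarify
      fix e :: "'a \<Rightarrow> nat" and d :: nat
      assume d: "d > 0" and inv: "semi_invariant (int_span G) B \<omega> d e"
      obtain u where u: "\<And>b. b \<in> B \<Longrightarrow> real (e b) = real d * real_of_int (\<omega> b) + u \<bullet> b"
        using semi_invariant_imp_linear[OF B inv] by blast
      have val: "?\<omega> b + (u /\<^sub>R real d) \<bullet> b = real (e b) / real d" if "b \<in> B" for b
        using u[OF that] d by (simp add: field_simps)
      then have "u /\<^sub>R real d \<in> feasible B ?\<omega>" by (simp add: feasible_def)
      moreover have "{b \<in> B. e b = 0} = tight B ?\<omega> (u /\<^sub>R real d)"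
        unfolding tight_def using val d by auto
      ultimately show "convex_cone hull {b \<in> B. e b = 0} \<in> regular_fan B ?\<omega>"
        unfolding regular_fan_def by simp
    qed
    show "regular_fan B ?\<omega>
        \<subseteq> {convex_cone hull {b \<in> B. e b = 0} | e d. d > 0 \<and> semi_invariant (int_span G) B \<omega> d e}"
    proof
      fix \<sigma> assume "\<sigma> \<in> regular_fan B ?\<omega>"
      then obtain u where u: "u \<in> feasible B ?\<omega>" "\<sigma> = convex_cone hull tight B ?\<omega> u"
        by (auto simp: regular_fan_def)
      obtain w where w: "w \<in> feasible B ?\<omega>" "tight B ?\<omega> w = tight B ?\<omega> u" "\<And>g. g \<in> G \<Longrightarrow> w \<bullet> g \<in> \<rat>"
        using rational_point_of_regular_fan[OF G B _ u(1)] by auto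
      obtain D where D: "0 < D" "\<And>g. g \<in> G \<Longrightarrow> real D * (w \<bullet> g) \<in> \<int>"
        using common_denominator[of G "\<lambda>g. w \<bullet> g"] w(3) independent_imp_finite[OF G(1)] by auto
      have dual: "real D *\<^sub>R w \<in> dual_lattice (int_span G)"
        using D(2) by (simp add: dual_lattice_int_span)
      define e where "e b = nat \<lfloor>real D * (?\<omega> b + w \<bullet> b)\<rfloor>" for b
      have e: "real (e b) = real D * real_of_int (\<omega> b) + (real D *\<^sub>R w) \<bullet> b" if b: "b \<in> B" for b
      proof -
        have "real D * ?\<omega> b + (real D *\<^sub>R w) \<bullet> b \<in> \<int>"
          using dual B(2) b by (intro Ints_add Ints_mult) (auto simp: dual_lattice_def)
        then have "real D * (?\<omega> b + w \<bullet> b) \<in> \<int>" by (simp add: algebra_simps)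
        moreover have "0 \<le> real D * (?\<omega> b + w \<bullet> b)"
          using w(1) b by (auto simp: feasible_def)
        ultimately have "real (e b) = real D * (?\<omega> b + w \<bullet> b)"
          unfolding e_def by (metis Ints_cases floor_of_int of_int_0_le_iff of_nat_nat)
        then show ?thesis by (simp add: algebra_simps)
      qed
      have "semi_invariant (int_span G) B \<omega> D e"
        using linear_imp_semi_invariant[OF B(1) dual B(2) e] .
      moreover have "{b \<in> B. e b = 0} = tight B ?\<omega> w"
      proof -
        have "e b = 0 \<longleftrightarrow> ?\<omega> b + w \<bullet> b = 0" if "b \<in> B" for b
        proof -
          have "real (e b) = real D * (?\<omega> b + w \<bullet> b)" using e[OF that] by (simp add: algebra_simps)
          then show ?thesis using D(1) by (metis mult_eq_0_iff of_nat_0_eq_iff less_numeral_extra(3))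
        qed
        then show ?thesis unfolding tight_def by blast
      qed
      ultimately show "\<sigma> \<in> {convex_cone hull {b \<in> B. e b = 0} | e d. d > 0 \<and> semi_invariant (int_span G) B \<omega> d e}"
        using D(1) u(2) w(2) by (intro CollectI exI[of _ e] exI[of _ D]) simp
    qed
  qed
  then show ?thesis by (simp add: git_quotient_def)
qed

lemma regular_fan_scale:
  assumes D: "0 < D" and eq: "\<And>b. b \<in> B \<Longrightarrow> \<omega>' b = D * \<omega> b"
  shows "regular_fan B \<omega>' = regular_fan B \<omega>"
proof -
  have val: "\<omega>' b + (D *\<^sub>R u) \<bullet> b = D * (\<omega> b + u \<bullet> b)" if "b \<in> B" for b u
    using eq[OF that] by (simp add: algebra_simps)
  have feas: "feasible B \<omega>' = (\<lambda>u. D *\<^sub>R u) ` feasible B \<omega>"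
  proof (intro equalityI subsetI)
    fix u assume u: "u \<in> feasible B \<omega>'"
    have Du: "D *\<^sub>R (u /\<^sub>R D) = u" using D by simp
    have "u /\<^sub>R D \<in> feasible B \<omega>"
      unfolding feasible_def mem_Collect_eq
    proof
      fix b assume b: "b \<in> B"
      have "\<omega>' b + u \<bullet> b = D * (\<omega> b + (u /\<^sub>R D) \<bullet> b)"
        using val[OF b, of "u /\<^sub>R D"] unfolding Du .
      moreover have "0 \<le> \<omega>' b + u \<bullet> b" using u b by (simp add: feasible_def)
      ultimately show "0 \<le> \<omega> b + (u /\<^sub>R D) \<bullet> b" using D zero_le_mult_iff[of D] by simp
    qed
    then show "u \<in> (\<lambda>u. D *\<^sub>R u) ` feasible B \<omega>" using Du by (metis image_eqI)
  next
    fix u assume "u \<in> (\<lambda>u. D *\<^sub>R u) ` feasible B \<omega>"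
    then show "u \<in> feasible B \<omega>'" using D val by (auto simp: feasible_def simp del: inner_scaleR_left)
  qed
  have tight: "tight B \<omega>' (D *\<^sub>R u) = tight B \<omega> u" for u
    using D val unfolding tight_def by auto
  show "regular_fan B \<omega>' = regular_fan B \<omega>"
    unfolding regular_fan_def feas image_image tight ..
qed

lemma regular_fan_is_git_quotient:
  fixes B :: "'a::euclidean_space set"
  assumes G: "independent G" "span G = UNIV" and B: "finite B"
    and prim: "\<And>b. b \<in> B \<Longrightarrow> primitive_vector (int_span G) b"
    and rat: "\<And>b. b \<in> B \<Longrightarrow> \<omega> b \<in> \<rat>" and rays: "all_rays B \<omega>"
  obtains \<omega>' where "git_quotient (int_span G) B \<omega>' = (int_span G, regular_fan B \<omega>)"
    "ray_generators (git_quotient (int_span G) B \<omega>') = B"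
proof -
  obtain D where D: "0 < D" "\<And>b. b \<in> B \<Longrightarrow> real D * \<omega> b \<in> \<int>"
    using common_denominator[of B \<omega>, OF B rat] by blast
  define \<omega>' where "\<omega>' b = \<lfloor>real D * \<omega> b\<rfloor>" for b
  have "real_of_int (\<omega>' b) = real D * \<omega> b" if "b \<in> B" for b
    using D(2)[OF that] by (simp add: \<omega>'_def)
  then have "regular_fan B (\<lambda>b. real_of_int (\<omega>' b)) = regular_fan B \<omega>"
    using D(1) by (intro regular_fan_scale[of "real D"]) auto
  moreover have "B \<subseteq> int_span G" using prim by (auto simp: primitive_vector_def)
  ultimately have "git_quotient (int_span G) B \<omega>' = (int_span G, regular_fan B \<omega>)"
    using git_quotient_eq_regular_fan[OF G B] by simp
  then show thesis
    using that ray_generators_regular_fan[OF rays prim] by metis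
qed

section \<open>Blow-ups that are related by variation of GIT\<close>

lemma extreme_points_linear_image:
  fixes f :: "'a::euclidean_space \<Rightarrow> 'a"
  assumes "linear f" "inj f"
  shows "{v. v extreme_point_of f ` R} = f ` {v. v extreme_point_of R}"
proof -
  have "v extreme_point_of f ` R \<longleftrightarrow> (\<exists>w. v = f w \<and> w extreme_point_of R)" for v
  proof
    assume v: "v extreme_point_of f ` R"
    then obtain w where w: "v = f w" by (auto simp: extreme_point_of_def)
    then have "f ` {w} face_of f ` R" using v by (simp add: face_of_singleton)
    then have "{w} face_of R" using face_of_linear_image assms by blast
    then show "\<exists>w. v = f w \<and> w extreme_point_of R" using w by (auto simp: face_of_singleton)
  next
    assume "\<exists>w. v = f w \<and> w extreme_point_of R"
    then obtain w where w: "v = f w" "{w} face_of R" by (auto simp: face_of_singleton)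
    then have "f ` {w} face_of f ` R" using face_of_linear_image assms by blast
    then show "v extreme_point_of f ` R" using w(1) by (simp add: face_of_singleton)
  qed
  then show ?thesis by blast
qed

lemma spanning_fan_linear_image:
  fixes f :: "'a::euclidean_space \<Rightarrow> 'a"
  assumes "linear f" "inj f"
  shows "spanning_fan (f ` R) = (\<lambda>\<sigma>. f ` \<sigma>) ` spanning_fan R"
proof -
  have "{F. F face_of f ` R \<and> F \<noteq> f ` R} = image f ` {F. F face_of R \<and> F \<noteq> R}"
  proof -
    have "{F. F face_of f ` R \<and> F \<noteq> f ` R} = {F. F face_of f ` R} - {f ` R}" by blast
    also have "\<dots> = image f ` {F. F face_of R} - {f ` R}"
      unfolding faces_of_linear_image[OF assms] ..
    also have "\<dots> = image f ` {F. F face_of R \<and> F \<noteq> R}"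
      using inj_image_eq_iff[OF assms(2)] by auto
    finally show ?thesis .
  qed
  then have "spanning_fan (f ` R) = (\<lambda>F. convex_cone hull F) ` image f ` {F. F face_of R \<and> F \<noteq> R}"
    unfolding spanning_fan_def by (simp add: setcompr_eq_image)
  then show ?thesis
    unfolding spanning_fan_def
    by (simp add: setcompr_eq_image image_image convex_cone_hull_linear_image[OF assms(1)])
qed

lemma primitive_vector_linear_image:
  assumes "linear f" "inj f" "primitive_vector (f ` \<Lambda>) (f v)"
  shows "primitive_vector \<Lambda> v"
  using assms unfolding primitive_vector_def
  by (metis inj_image_mem_iff linear_0 linear_cmul)

text \<open>
  Transport \<open>R'\<close> to the lattice of \<open>R\<close> by the inverse of \<open>\<theta>\<close>; there its vertices contain those of \<open>R\<close>, and
  the remaining ones are the centres of the blow-ups.  Both fans become regular fans on the same set of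
  vectors.
\<close>

lemma blowup_related_by_toric_VGIT:
  fixes R R' G :: "'a::euclidean_space set" and \<theta> :: "'a \<Rightarrow> 'a"
  assumes G: "independent G" "span G = UNIV"
    and \<theta>: "linear \<theta>" "bij \<theta>" "\<theta> ` int_span G = \<Lambda>'"
    and R: "polytope R" "0 \<in> interior R" and R': "polytope R'" "0 \<in> interior R'"
    and vert: "\<And>v. v extreme_point_of R \<Longrightarrow> \<theta> v extreme_point_of R'"
    and prim: "\<And>v. v extreme_point_of R' \<Longrightarrow> primitive_vector \<Lambda>' v"
  shows "\<exists>X. toric_blowup (toric_variety_of (int_span G, R)) X \<and>
             toric_VGIT (toric_variety_of (\<Lambda>', R')) X"
proof -
  define f where "f = inv \<theta>"
  have f: "linear f" "bij f"
    unfolding f_def using \<theta> by (simp_all add: inj_linear_imp_inv_linear bij_is_inj bij_imp_bij_inv)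
  then have injf: "inj f" by (simp add: bij_is_inj)
  have \<theta>f: "\<theta> (f x) = x" and f\<theta>: "f (\<theta> x) = x" for x
    unfolding f_def using \<theta>(2) by (simp_all add: bij_is_surj bij_is_inj surj_f_inv_f)
  have f\<Lambda>: "f ` \<Lambda>' = int_span G"
    unfolding \<theta>(3)[symmetric] image_image f\<theta> by simp
  define S where "S = f ` R'"
  have S: "polytope S" "0 \<in> interior S"
    unfolding S_def using R' f interior_bijective_linear_image[OF f, of R'] linear_0[OF f(1)]
    by (auto simp: polytope_linear_image intro!: image_eqI[of 0 f 0])
  let ?B = "{v. v extreme_point_of S}" and ?A = "{v. v extreme_point_of R}"
  have B: "?B = f ` {v. v extreme_point_of R'}"
    unfolding S_def by (rule extreme_points_linear_image[OF f(1) injf])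
  have AB: "?A \<subseteq> ?B"
  proof
    fix v assume "v \<in> ?A"
    then have "\<theta> v extreme_point_of R'" using vert by simp
    then have "f (\<theta> v) \<in> ?B" unfolding B by blast
    then show "v \<in> ?B" by (simp add: f\<theta>)
  qed
  have primB: "primitive_vector (int_span G) b" if b: "b \<in> ?B" for b
  proof -
    obtain w where w: "b = f w" "w extreme_point_of R'" using b B by blast
    then have "primitive_vector (\<theta> ` int_span G) (\<theta> b)" using prim \<theta>(3) \<theta>f by simp
    then show ?thesis by (rule primitive_vector_linear_image[OF \<theta>(1) bij_is_inj[OF \<theta>(2)]])
  qed
  have finA: "finite ?A" and finB: "finite ?B"
    using polytope_eq_hull_extreme_points(1)[OF R(1)] polytope_eq_hull_extreme_points(1)[OF S(1)] .
  have cpt: "compact (feasible ?A (\<lambda>_. 1))"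
    using compact_feasible[OF finA] R(2) polytope_eq_hull_extreme_points(2)[OF R(1)] by simp
  obtain \<omega> where \<omega>: "toric_blowup (int_span G, regular_fan ?A (\<lambda>_. 1)) (int_span G, regular_fan (?A \<union> (?B - ?A)) \<omega>)"
    "all_rays (?A \<union> (?B - ?A)) \<omega>" "\<forall>b\<in>?A \<union> (?B - ?A). \<omega> b \<in> \<rat>"
    using toric_blowup_regular_fan[OF _ finA _ all_rays_extreme_points[OF R] cpt, of "?B - ?A" "int_span G"]
      finB AB primB by (auto simp: subset_iff)
  have U: "?A \<union> (?B - ?A) = ?B" using AB by blast
  obtain \<omega>1 where \<omega>1: "git_quotient (int_span G) ?B \<omega>1 = (int_span G, regular_fan ?B \<omega>)"
    "ray_generators (git_quotient (int_span G) ?B \<omega>1) = ?B"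
    using regular_fan_is_git_quotient[OF G finB primB, of \<omega>] \<omega>(2,3) unfolding U by blast
  obtain \<omega>2 where \<omega>2: "git_quotient (int_span G) ?B \<omega>2 = (int_span G, regular_fan ?B (\<lambda>_. 1))"
    "ray_generators (git_quotient (int_span G) ?B \<omega>2) = ?B"
    using regular_fan_is_git_quotient[OF G finB primB, of "\<lambda>_. 1"] all_rays_extreme_points[OF S] by auto
  have "toric_iso (\<Lambda>', spanning_fan R') (int_span G, spanning_fan S)"
    unfolding toric_iso_def
    using f f\<Lambda> spanning_fan_linear_image[OF f(1) injf, of R'] by (intro exI[of _ f]) (simp add: S_def)
  moreover have "toric_iso (int_span G, regular_fan ?B \<omega>) (int_span G, regular_fan ?B \<omega>)"
    unfolding toric_iso_def by (intro exI[of _ id]) (simp add: linear_id)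
  ultimately have "toric_VGIT (\<Lambda>', spanning_fan R') (int_span G, regular_fan ?B \<omega>)"
    unfolding toric_VGIT_def spanning_fan_eq_regular_fan[OF S]
    using finB \<omega>1 \<omega>2 by (intro exI[of _ "int_span G"] exI[of _ ?B] exI[of _ \<omega>2] exI[of _ \<omega>1]) simp
  then show ?thesis
    using \<omega>(1) unfolding U toric_variety_of_def by (auto simp: spanning_fan_eq_regular_fan[OF R])
qed

section \<open>Polar sets\<close>

lemma bipolar_eq:
  fixes R :: "'a::euclidean_space set"
  assumes "convex R" "closed R" "0 \<in> R"
  shows "polar (polar R) = R"
proof
  show "R \<subseteq> polar (polar R)" by (auto simp: polar_def inner_commute)
  show "polar (polar R) \<subseteq> R"
  proof
    fix x assume x: "x \<in> polar (polar R)"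
    show "x \<in> R"
    proof (rule ccontr)
      assume "x \<notin> R"
      then obtain a \<beta> where a: "a \<bullet> x < \<beta>" "\<forall>y\<in>R. \<beta> < a \<bullet> y"
        using separating_hyperplane_closed_point[OF assms(1,2)] by blast
      then have \<beta>: "\<beta> < 0" using assms(3) by force
      have "a /\<^sub>R (- \<beta>) \<in> polar R"
        using a(2) \<beta> by (force simp: polar_def field_simps)
      then have "-1 \<le> x \<bullet> (a /\<^sub>R (- \<beta>))" using x unfolding polar_def[of "polar R"] by blast
      then show False using a(1) \<beta> by (simp add: field_simps inner_commute)
    qed
  qed
qed

lemma zero_in_interior_polar:
  fixes R :: "'a::euclidean_space set"
  assumes "bounded R"
  shows "0 \<in> interior (polar R)"
proof -
  obtain M where M: "0 < M" "\<forall>x\<in>R. norm x \<le> M" using assms bounded_pos by blast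
  have "ball (0::'a) (1 / M) \<subseteq> polar R"
  proof
    fix v assume "v \<in> ball (0::'a) (1 / M)"
    then have v: "norm v < 1 / M" by simp
    have "-1 \<le> v \<bullet> w" if "w \<in> R" for w
    proof -
      have "\<bar>v \<bullet> w\<bar> \<le> norm v * norm w" by (rule Cauchy_Schwarz_ineq2)
      also have "\<dots> \<le> (1 / M) * M" using v M that by (intro mult_mono) auto
      finally show ?thesis using M(1) by simp
    qed
    then show "v \<in> polar R" by (simp add: polar_def)
  qed
  then show ?thesis using M(1) by (intro interiorI[of "ball (0::'a) (1 / M)"]) auto
qed

lemma polar_convex_hull: "polar (convex hull W) = polar W"
proof
  show "polar (convex hull W) \<subseteq> polar W" by (auto simp: polar_def hull_inc)
  show "polar W \<subseteq> polar (convex hull W)"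
  proof
    fix v assume v: "v \<in> polar W"
    have "convex hull W \<subseteq> {w. - 1 \<le> v \<bullet> w}"
      using v by (intro hull_minimal) (auto simp: polar_def convex_halfspace_ge)
    then show "v \<in> polar (convex hull W)" by (auto simp: polar_def)
  qed
qed

lemma polyhedron_polar:
  fixes W :: "'a::euclidean_space set"
  assumes "finite W" shows "polyhedron (polar W)"
proof -
  have "polar W = (\<Inter>w\<in>W. {y. - 1 \<le> w \<bullet> y})" by (auto simp: polar_def inner_commute)
  moreover have "polyhedron {y. - 1 \<le> w \<bullet> y}" for w :: 'a
    by (rule polyhedron_halfspace_ge)
  ultimately show ?thesis using assms by (auto intro!: polyhedron_Inter)
qed

section \<open>Paths in the grid quiver\<close>

fun path_height :: "nat \<Rightarrow> quiver_vertex \<Rightarrow> int" where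
  "path_height n (Box i j) = int i + int j - 1"
| "path_height n Upper = 0"
| "path_height n Rightmost = int n"

text \<open>
  For an arrow from \<open>s\<close> to \<open>t\<close>, the difference \<open>path_form n t v - path_form n s v\<close> is the indicator
  function (in \<open>v\<close>) of the filter of the grid that is assigned to the arrow: everything for the arrow
  from \<open>Upper\<close>; the rows below row \<open>i\<close> together with the part of row \<open>i\<close> strictly to the right of column
  \<open>j\<close> for the arrow down from \<open>Box i j\<close>; the columns beyond column \<open>j + 1\<close> together with the part of
  column \<open>j + 1\<close> from row \<open>i\<close> downwards for the arrow to the right from \<open>Box i j\<close>; nothing for the arrow to
  \<open>Rightmost\<close>.  The vertices \<open>Upper\<close> and \<open>Rightmost\<close> in the place of \<open>v\<close> count as lying outside and
  inside of all filters, respectively.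
\<close>

fun path_form :: "nat \<Rightarrow> quiver_vertex \<Rightarrow> quiver_vertex \<Rightarrow> int" where
  "path_form n (Box i j) (Box p q) =
     min (int i) (int p) + min (int j) (int q) - 1 + (if p < i \<and> j < q then 1 else 0)"
| "path_form n (Box i j) Upper = 0"
| "path_form n (Box i j) Rightmost = path_height n (Box i j)"
| "path_form n Upper v = 0"
| "path_form n Rightmost v = path_height n v"

lemma quiver_arrow_cases:
  assumes "(s, t) \<in> quiver_arrows n r"
  obtains (right) i j where "s = Box i j" "t = Box i (j + 1)" "1 \<le> i" "i \<le> r" "1 \<le> j" "j < n - r"
  | (down) i j where "s = Box i j" "t = Box (i + 1) j" "1 \<le> i" "i < r" "1 \<le> j" "j \<le> n - r"
  | (start) "s = Upper" "t = Box 1 1"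
  | (final) "s = Box r (n - r)" "t = Rightmost"
proof -
  have "(\<exists>i j. s = Box i j \<and> t = Box i (j + 1) \<and> 1 \<le> i \<and> i \<le> r \<and> 1 \<le> j \<and> j < n - r) \<or>
    (\<exists>i j. s = Box i j \<and> t = Box (i + 1) j \<and> 1 \<le> i \<and> i < r \<and> 1 \<le> j \<and> j \<le> n - r) \<or>
    (s = Upper \<and> t = Box 1 1) \<or> (s = Box r (n - r) \<and> t = Rightmost)"
    using assms unfolding quiver_arrows_def Let_def Un_iff mem_Collect_eq insert_iff empty_iff prod.inject by blast
  then show thesis
    by (elim disjE exE conjE) (fact right, fact down, fact start, fact final)
qed

lemma finite_quiver_arrows: "finite (quiver_arrows n r)"
proof -
  let ?S = "(\<lambda>(i, j). (Box i j, Box i (j + 1))) ` ({..r} \<times> {..n}) \<union>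
    (\<lambda>(i, j). (Box i j, Box (i + 1) j)) ` ({..r} \<times> {..n}) \<union>
    {(Upper, Box 1 1), (Box r (n - r), Rightmost)}"
  have "a \<in> ?S" if a: "a \<in> quiver_arrows n r" for a
  proof -
    obtain s t where st: "a = (s, t)" by (cases a)
    from a[unfolded st] show ?thesis
      unfolding st by (cases rule: quiver_arrow_cases) force+
  qed
  then have "quiver_arrows n r \<subseteq> ?S" by blast
  then show ?thesis by (rule finite_subset) simp
qed

lemma path_height_arrow:
  assumes "r < n" "(s, t) \<in> quiver_arrows n r"
  shows "path_height n t = path_height n s + 1"
  using assms(2) by (cases rule: quiver_arrow_cases) (use assms(1) in auto)

text \<open>
  The sets assigned to the arrows are filters: no arrow leaves one of them.
\<close>

lemma path_form_mixed_difference: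
  assumes "r < n" and a: "(s, t) \<in> quiver_arrows n r" and b: "(s', t') \<in> quiver_arrows n r"
  shows "path_form n t t' - path_form n s t' - path_form n t s' + path_form n s s' \<in> {0, 1}"
  by (rule quiver_arrow_cases[OF a]; rule quiver_arrow_cases[OF b])
     (use assms(1) in \<open>auto simp: min_def split: if_splits\<close>)

locale grid_quiver =
  fixes n r :: nat and e :: "nat \<times> nat \<Rightarrow> 'a::euclidean_space"
  assumes r_less_n: "r < n" and r_pos: "0 < r"
    and e: "bij_betw e ({1..r} \<times> {1..n - r}) Basis"
begin

abbreviation "arrows \<equiv> quiver_arrows n r"
abbreviation "boxes \<equiv> {1..r} \<times> {1..n - r}"
abbreviation "vec_of \<equiv> vertex_vector e"
abbreviation "ht \<equiv> path_height n"

definition arrow_vector :: "quiver_vertex \<Rightarrow> quiver_vertex \<Rightarrow> 'a" where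
  "arrow_vector s t = - vec_of s + vec_of t"

definition arrow_vectors :: "'a set" where
  "arrow_vectors = {arrow_vector s t | s t. (s, t) \<in> arrows}"

lemma P_polytope_eq: "P_polytope n r e = (int_span Basis, convex hull arrow_vectors)"
  using e by (simp add: P_polytope_def arrow_vectors_def arrow_vector_def bij_betw_def)

lemma finite_arrow_vectors: "finite arrow_vectors"
proof -
  have "arrow_vectors = (\<lambda>(s, t). arrow_vector s t) ` arrows"
    by (auto simp: arrow_vectors_def)
  then show ?thesis by (simp add: finite_quiver_arrows)
qed

lemma start_arrow: "(Upper, Box 1 1) \<in> arrows"
  and final_arrow: "(Box r (n - r), Rightmost) \<in> arrows"
  and right_arrow: "1 \<le> i \<Longrightarrow> i \<le> r \<Longrightarrow> 1 \<le> j \<Longrightarrow> j < n - r \<Longrightarrow> (Box i j, Box i (j + 1)) \<in> arrows"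
  and down_arrow: "1 \<le> i \<Longrightarrow> i < r \<Longrightarrow> 1 \<le> j \<Longrightarrow> j \<le> n - r \<Longrightarrow> (Box i j, Box (i + 1) j) \<in> arrows"
  unfolding quiver_arrows_def Let_def by blast+

lemma forward_induct:
  assumes "(i, j) \<in> boxes" and "Q Upper"
    and step: "\<And>s t. (s, t) \<in> arrows \<Longrightarrow> Q s \<Longrightarrow> Q t"
  shows "Q (Box i j)"
proof -
  have col: "1 \<le> m \<Longrightarrow> m \<le> r \<Longrightarrow> Q (Box m 1)" for m
  proof (induction m rule: nat_induct_at_least)
    case base
    then show ?case using step[OF start_arrow] \<open>Q Upper\<close> by simp
  next
    case (Suc m)
    then show ?case using step[OF down_arrow[of m 1]] r_less_n by simp
  qed
  have "1 \<le> m \<Longrightarrow> m \<le> n - r \<Longrightarrow> Q (Box i m)" for m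
  proof (induction m rule: nat_induct_at_least)
    case base
    then show ?case using col assms(1) by simp
  next
    case (Suc m)
    then show ?case using step[OF right_arrow[of i m]] assms(1) by simp
  qed
  then show ?thesis using assms(1) by simp
qed

lemma backward_induct:
  assumes "(i, j) \<in> boxes" and "Q Rightmost"
    and step: "\<And>s t. (s, t) \<in> arrows \<Longrightarrow> Q t \<Longrightarrow> Q s"
  shows "Q (Box i j)"
proof -
  have row: "1 \<le> j \<Longrightarrow> Q (Box r j)" if "j \<le> n - r" for j
    using that
  proof (induction j rule: inc_induct)
    case base
    then show ?case using step[OF final_arrow] \<open>Q Rightmost\<close> by simp
  next
    case (step m)
    then show ?case using assms(3)[OF right_arrow[of r m]] r_pos by simp
  qed
  have "i \<le> r" using assms(1) by simp
  then have "1 \<le> i \<Longrightarrow> Q (Box i j)"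
  proof (induction i rule: inc_induct)
    case base
    then show ?case using row assms(1) by simp
  next
    case (step m)
    then show ?case using assms(3)[OF down_arrow[of m j]] assms(1) by simp
  qed
  then show ?thesis using assms(1) by simp
qed

definition vertices :: "quiver_vertex set" where
  "vertices = {Upper, Rightmost} \<union> {Box i j | i j. (i, j) \<in> boxes}"

lemma vertex_cases:
  assumes "v \<in> vertices"
  obtains "v = Upper" | "v = Rightmost" | i j where "v = Box i j" "(i, j) \<in> boxes"
  using assms unfolding vertices_def by blast

lemma Box_in_vertices: "(i, j) \<in> boxes \<Longrightarrow> Box i j \<in> vertices"
  unfolding vertices_def by blast

lemma arrow_vertices:
  assumes "(s, t) \<in> arrows"
  shows "s \<in> vertices" "t \<in> vertices"
  using assms by (cases rule: quiver_arrow_cases; use r_less_n r_pos in \<open>auto simp: vertices_def\<close>)+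

section \<open>The polar of $P_{n,r}$ and its vertices\<close>

text \<open>
  The coordinate of \<open>y + \<rho>\<close> at a vertex, extended by \<open>0\<close> and \<open>n\<close> to the external vertices.  In these
  terms the polar of \<open>P\<close> consists of the functions that are weakly increasing along all arrows.
\<close>

definition level :: "'a \<Rightarrow> quiver_vertex \<Rightarrow> real" where
  "level y v = y \<bullet> vec_of v + real_of_int (ht v)"

lemma level_external [simp]: "level y Upper = 0" "level y Rightmost = real n"
  by (simp_all add: level_def)

lemma level_Box: "level y (Box i j) = y \<bullet> e (i, j) + real_of_int (ht (Box i j))"
  by (simp add: level_def)

lemma inner_arrow_vector:
  assumes "(s, t) \<in> arrows"
  shows "y \<bullet> arrow_vector s t = level y t - level y s - 1"
  using path_height_arrow[OF r_less_n assms]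
  by (simp add: arrow_vector_def level_def inner_diff_right inner_add_right)

lemma mem_polar_iff:
  "y \<in> polar (convex hull arrow_vectors) \<longleftrightarrow> (\<forall>(s, t)\<in>arrows. level y s \<le> level y t)"
proof -
  have "y \<in> polar (convex hull arrow_vectors) \<longleftrightarrow> (\<forall>(s, t)\<in>arrows. -1 \<le> y \<bullet> arrow_vector s t)"
    unfolding polar_convex_hull by (auto simp: polar_def arrow_vectors_def)
  also have "\<dots> \<longleftrightarrow> (\<forall>(s, t)\<in>arrows. level y s \<le> level y t)"
    by (intro ball_cong HOL.refl) (auto simp: inner_arrow_vector)
  finally show ?thesis .
qed

text \<open>
  The vectors with levels \<open>0\<close> and \<open>n\<close> only, increasing along arrows.  This form of the definition does not
  refer to coordinates, which makes it easy to verify for the image of a transposed map.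
\<close>

definition filter_vectors :: "'a set" where
  "filter_vectors = {y. \<forall>w\<in>arrow_vectors. y \<bullet> w \<in> {- 1, real n - 1}}"

lemma mem_filter_vectors_iff:
  "y \<in> filter_vectors \<longleftrightarrow> (\<forall>(s, t)\<in>arrows. level y t - level y s \<in> {0, real n})"
proof -
  have "y \<in> filter_vectors \<longleftrightarrow> (\<forall>(s, t)\<in>arrows. y \<bullet> arrow_vector s t \<in> {- 1, real n - 1})"
    unfolding filter_vectors_def arrow_vectors_def by auto
  also have "\<dots> \<longleftrightarrow> (\<forall>(s, t)\<in>arrows. level y t - level y s \<in> {0, real n})"
    by (intro ball_cong HOL.refl) (auto simp: inner_arrow_vector)
  finally show ?thesis .
qed

lemma level_bounds:
  assumes "y \<in> polar (convex hull arrow_vectors)" "(i, j) \<in> boxes"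
  shows "0 \<le> level y (Box i j)" "level y (Box i j) \<le> real n"
proof -
  have step: "level y s \<le> level y t" if "(s, t) \<in> arrows" for s t
    using assms(1) that by (auto simp: mem_polar_iff)
  show "0 \<le> level y (Box i j)"
    using assms(2) by (rule forward_induct[where Q = "\<lambda>v. 0 \<le> level y v"]) (auto dest: step)
  show "level y (Box i j) \<le> real n"
    using assms(2) by (rule backward_induct[where Q = "\<lambda>v. level y v \<le> real n"]) (auto dest: step)
qed

lemma box_of_Basis:
  assumes "b \<in> Basis"
  obtains i j where "(i, j) \<in> boxes" "b = e (i, j)"
proof -
  have "b \<in> e ` boxes" using assms e by (simp add: bij_betw_def)
  then show thesis using that by auto
qed

lemma e_in_Basis: "(i, j) \<in> boxes \<Longrightarrow> e (i, j) \<in> Basis"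
  using e by (auto simp: bij_betw_def)

lemma bounded_polar: "bounded (polar (convex hull arrow_vectors))"
proof -
  have "norm y \<le> (\<Sum>b\<in>(Basis :: 'a set). real n)" if y: "y \<in> polar (convex hull arrow_vectors)" for y
  proof -
    have "\<bar>y \<bullet> b\<bar> \<le> real n" if b: "b \<in> Basis" for b
    proof -
      obtain i j where ij: "(i, j) \<in> boxes" "b = e (i, j)" using box_of_Basis[OF b] by blast
      have "y \<bullet> b = level y (Box i j) - real_of_int (ht (Box i j))" using ij by (simp add: level_Box)
      moreover have "0 \<le> ht (Box i j)" "ht (Box i j) \<le> int n" using ij(1) r_less_n by auto
      ultimately show ?thesis using level_bounds[OF y ij(1)] by linarith
    qed
    then show ?thesis by (intro order_trans[OF norm_le_l1] sum_mono) auto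
  qed
  then show ?thesis unfolding bounded_iff by blast
qed

lemma polytope_polar: "polytope (polar (convex hull arrow_vectors))"
  using polyhedron_polar[OF finite_arrow_vectors] bounded_polar
  by (simp add: polytope_eq_bounded_polyhedron polar_convex_hull)

lemma zero_in_hull: "0 \<in> convex hull arrow_vectors"
proof (rule ccontr)
  assume "0 \<notin> convex hull arrow_vectors"
  moreover have "closed (convex hull arrow_vectors)"
    using finite_arrow_vectors finite_imp_compact_convex_hull compact_imp_closed by blast
  ultimately obtain a \<beta> where a: "a \<bullet> 0 < \<beta>" "\<forall>x\<in>convex hull arrow_vectors. \<beta> < a \<bullet> x"
    using separating_hyperplane_closed_point[OF convex_convex_hull] by metis
  have incr: "a \<bullet> vec_of s < a \<bullet> vec_of t" if "(s, t) \<in> arrows" for s t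
  proof -
    have "arrow_vector s t \<in> convex hull arrow_vectors"
      using that by (intro hull_inc) (auto simp: arrow_vectors_def)
    then have "0 < a \<bullet> arrow_vector s t" using a by force
    then show ?thesis by (simp add: arrow_vector_def inner_diff_right inner_add_right)
  qed
  have "0 < a \<bullet> vec_of (Box 1 1)" using incr[OF start_arrow] by simp
  moreover have "(1, 1) \<in> boxes" using r_less_n r_pos by simp
  then have "a \<bullet> vec_of (Box 1 1) \<le> 0"
    by (rule backward_induct[where Q = "\<lambda>v. a \<bullet> vec_of v \<le> 0"]) (auto dest: incr)
  ultimately show False by simp
qed

lemma bipolar: "polar (polar (convex hull arrow_vectors)) = convex hull arrow_vectors"
  using zero_in_hull finite_arrow_vectors
  by (intro bipolar_eq) (auto simp: finite_imp_compact_convex_hull compact_imp_closed)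

lemma zero_in_interior_hull: "0 \<in> interior (convex hull arrow_vectors)"
  using zero_in_interior_polar[OF bounded_polar] by (simp add: bipolar)

lemma zero_in_interior_dual: "0 \<in> interior (polar (convex hull arrow_vectors))"
  using zero_in_interior_polar[of "convex hull arrow_vectors"] finite_arrow_vectors
  by (simp add: finite_imp_bounded_convex_hull)

lemma filter_vectors_subset_polar: "filter_vectors \<subseteq> polar (convex hull arrow_vectors)"
  by (force simp: mem_filter_vectors_iff mem_polar_iff)

text \<open>
  Along a path from \<open>Upper\<close> to \<open>Rightmost\<close> the levels go from \<open>0\<close> to \<open>n\<close> in steps of \<open>0\<close> or \<open>n\<close>.
\<close>

lemma level_filter_vector:
  assumes y: "y \<in> filter_vectors" and ij: "(i, j) \<in> boxes"
  shows "level y (Box i j) \<in> {0, real n}"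
proof -
  have "\<exists>m::int. level y (Box i j) = real_of_int m * real n"
    using ij
  proof (rule forward_induct[where Q = "\<lambda>v. \<exists>m::int. level y v = real_of_int m * real n"])
    fix s t assume "(s, t) \<in> arrows" "\<exists>m::int. level y s = real_of_int m * real n"
    then obtain m :: int where m: "level y s = real_of_int m * real n"
      and d: "level y t - level y s \<in> {0, real n}"
      using y by (force simp: mem_filter_vectors_iff)
    from d consider "level y t = real_of_int m * real n" | "level y t = real_of_int (m + 1) * real n"
      using m by (auto simp: algebra_simps)
    then show "\<exists>m::int. level y t = real_of_int m * real n" by cases blast+
  qed (auto intro: exI[of _ 0])
  then obtain m :: int where m: "level y (Box i j) = real_of_int m * real n" by blast
  have n: "0 < real n" using r_less_n by simp
  have "0 \<le> real_of_int m * real n" "real_of_int m * real n \<le> 1 * real n"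
    using level_bounds[of y i j] y ij filter_vectors_subset_polar m by auto
  then have "0 \<le> m" "m \<le> 1" using n by (auto simp: zero_le_mult_iff)
  then have "m = 0 \<or> m = 1" by linarith
  then show ?thesis using m by auto
qed

lemma eq_if_levels_eq:
  assumes "\<And>i j. (i, j) \<in> boxes \<Longrightarrow> level x (Box i j) = level y (Box i j)"
  shows "x = y"
proof (rule euclidean_eqI)
  fix b :: 'a assume "b \<in> Basis"
  then obtain i j where "(i, j) \<in> boxes" "b = e (i, j)" using box_of_Basis by blast
  then show "x \<bullet> b = y \<bullet> b" using assms[of i j] by (simp add: level_Box)
qed

lemma level_affine: "level ((1 - u) *\<^sub>R x + u *\<^sub>R y) v = (1 - u) * level x v + u * level y v"
  by (simp add: level_def algebra_simps)

text \<open>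
  All levels of points of the polar lie in the interval from \<open>0\<close> to \<open>n\<close>, so a point all of whose levels are
  endpoints of this interval is a corner even of a cube that contains the polar.
\<close>

lemma filter_vector_extreme:
  assumes y: "y \<in> filter_vectors"
  shows "y extreme_point_of polar (convex hull arrow_vectors)"
  unfolding extreme_point_of_def
proof (intro conjI ballI notI)
  let ?P = "polar (convex hull arrow_vectors)"
  show "y \<in> ?P" using y filter_vectors_subset_polar by blast
  fix a b assume ab: "a \<in> ?P" "b \<in> ?P" "y \<in> open_segment a b"
  then obtain u where u: "0 < u" "u < 1" "y = (1 - u) *\<^sub>R a + u *\<^sub>R b" and "a \<noteq> b"
    by (auto simp: in_segment)
  have "a = b"
  proof (rule eq_if_levels_eq)
    fix i j assume ij: "(i, j) \<in> boxes"
    define x z where "x = level a (Box i j)" and "z = level b (Box i j)"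
    have b: "0 \<le> x" "x \<le> real n" "0 \<le> z" "z \<le> real n"
      using level_bounds[OF ab(1) ij] level_bounds[OF ab(2) ij] by (auto simp: x_def z_def)
    have eq: "level y (Box i j) = (1 - u) * x + u * z"
      unfolding u(3) level_affine x_def z_def ..
    consider "level y (Box i j) = 0" | "level y (Box i j) = real n"
      using level_filter_vector[OF y ij] by blast
    then have "x = z"
    proof cases
      case 1
      then have "(1 - u) * x = 0 \<and> u * z = 0"
        using eq b u by (subst add_nonneg_eq_0_iff[symmetric]) auto
      then show ?thesis using u by simp
    next
      case 2
      then have "(1 - u) * (real n - x) + u * (real n - z) = 0"
        using eq by (simp add: algebra_simps)
      then have "(1 - u) * (real n - x) = 0 \<and> u * (real n - z) = 0"
        using b u by (subst add_nonneg_eq_0_iff[symmetric]) auto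
      then show ?thesis using u by simp
    qed
    then show "level a (Box i j) = level b (Box i j)" by (simp add: x_def z_def)
  qed
  then show False using \<open>a \<noteq> b\<close> by simp
qed

definition level_set_vector :: "'a \<Rightarrow> real \<Rightarrow> 'a" where
  "level_set_vector y c = (\<Sum>b\<in>{b \<in> Basis. \<exists>i j. (i, j) \<in> boxes \<and> b = e (i, j) \<and> level y (Box i j) = c}. b)"

lemma level_set_vector_inner:
  assumes "(i, j) \<in> boxes"
  shows "level_set_vector y c \<bullet> e (i, j) = (if level y (Box i j) = c then 1 else 0)"
proof -
  let ?S = "{b \<in> Basis. \<exists>i j. (i, j) \<in> boxes \<and> b = e (i, j) \<and> level y (Box i j) = c}"
  have fin: "finite ?S" by (rule finite_subset[OF _ finite_Basis]) blast
  have "b \<bullet> e (i, j) = (if b = e (i, j) then 1 else 0)" if "b \<in> ?S" for b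
    using that e_in_Basis[OF assms] by (auto simp: inner_Basis)
  then have "level_set_vector y c \<bullet> e (i, j) = (\<Sum>b\<in>?S. if b = e (i, j) then 1 else 0)"
    unfolding level_set_vector_def inner_sum_left by (rule sum.cong[OF HOL.refl])
  also have "\<dots> = (if e (i, j) \<in> ?S then 1 else 0)" using fin by simp
  also have "e (i, j) \<in> ?S \<longleftrightarrow> level y (Box i j) = c"
  proof
    assume "e (i, j) \<in> ?S"
    then obtain i' j' where ij': "(i', j') \<in> boxes" "e (i, j) = e (i', j')" "level y (Box i' j') = c" by blast
    then have "(i, j) = (i', j')" using e assms unfolding bij_betw_def inj_on_def by blast
    then show "level y (Box i j) = c" using ij'(3) by simp
  qed (use assms e_in_Basis in blast)
  finally show ?thesis .
qed

text \<open>
  If some level \<open>c\<close> lies strictly between \<open>0\<close> and \<open>n\<close>, then all boxes of level \<open>c\<close> can be moved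
  simultaneously up and down by a small amount without violating monotonicity.
\<close>

lemma extreme_point_levels:
  assumes ext: "y extreme_point_of polar (convex hull arrow_vectors)" and v: "v \<in> vertices"
  shows "level y v \<in> {0, real n}"
  using v
proof (cases rule: vertex_cases)
  case (3 i j)
  note ij = 3(2)
  have "level y (Box i j) \<in> {0, real n}"
  proof (rule ccontr)
    let ?P = "polar (convex hull arrow_vectors)"
    assume "level y (Box i j) \<notin> {0, real n}"
    define c where "c = level y (Box i j)"
    define d where "d = level_set_vector y c"
    have yP: "y \<in> ?P" using ext by (simp add: extreme_point_of_def)
    have c: "0 < c" "c < real n"
      using level_bounds[OF yP ij] \<open>level y (Box i j) \<notin> {0, real n}\<close> by (auto simp: c_def)
    have lev: "level (y + \<delta> *\<^sub>R d) v = level y v + \<delta> * (if level y v = c then 1 else 0)"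
      if "v \<in> vertices" for v \<delta>
      using that
    proof (cases rule: vertex_cases)
      case (3 i j)
      then show ?thesis
        using level_set_vector_inner[OF 3(2), of y c] by (simp add: level_Box d_def algebra_simps)
    qed (use c in auto)
    obtain \<delta> where \<delta>: "0 < \<delta>"
      "\<And>a. a \<in> {(s, t) \<in> arrows. level y s < level y t} \<Longrightarrow> \<delta> * 1 < level y (snd a) - level y (fst a)"
    proof (rule uniform_small_multiple[of "{(s, t) \<in> arrows. level y s < level y t}"
          "\<lambda>a. level y (snd a) - level y (fst a)" "\<lambda>_. 1"])
      show "finite {(s, t) \<in> arrows. level y s < level y t}"
        using finite_quiver_arrows by (rule finite_subset[rotated]) blast
    qed (use that in auto)
    have mem: "y + \<epsilon> *\<^sub>R d \<in> ?P" if \<epsilon>: "\<bar>\<epsilon>\<bar> = \<delta>" for \<epsilon>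
      unfolding mem_polar_iff
    proof clarify
      fix s t assume st: "(s, t) \<in> arrows"
      have ls: "level (y + \<epsilon> *\<^sub>R d) s = level y s + \<epsilon> * (if level y s = c then 1 else 0)"
        by (rule lev[OF arrow_vertices(1)[OF st]])
      have lt: "level (y + \<epsilon> *\<^sub>R d) t = level y t + \<epsilon> * (if level y t = c then 1 else 0)"
        by (rule lev[OF arrow_vertices(2)[OF st]])
      have "level y s \<le> level y t" using yP st by (auto simp: mem_polar_iff)
      then consider "level y s = level y t" | "\<delta> < level y t - level y s"
        using \<delta>(2)[of "(s, t)"] st by fastforce
      then show "level (y + \<epsilon> *\<^sub>R d) s \<le> level (y + \<epsilon> *\<^sub>R d) t"
        unfolding ls lt using \<epsilon> \<delta>(1) by cases auto
    qed
    have "d \<bullet> e (i, j) = 1" unfolding d_def using level_set_vector_inner[OF ij] by (simp add: c_def)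
    have "y \<in> open_segment (y + (- \<delta>) *\<^sub>R d) (y + \<delta> *\<^sub>R d)"
      unfolding in_segment
    proof (intro conjI exI[of _ "1 / 2"])
      show "y + (- \<delta>) *\<^sub>R d \<noteq> y + \<delta> *\<^sub>R d"
      proof
        assume "y + (- \<delta>) *\<^sub>R d = y + \<delta> *\<^sub>R d"
        then have "(y + (- \<delta>) *\<^sub>R d) \<bullet> e (i, j) = (y + \<delta> *\<^sub>R d) \<bullet> e (i, j)" by (rule arg_cong)
        then show False using \<open>d \<bullet> e (i, j) = 1\<close> \<delta>(1) by (simp add: inner_add_left inner_diff_left)
      qed
      show "y = (1 - 1 / 2) *\<^sub>R (y + (- \<delta>) *\<^sub>R d) + (1 / 2) *\<^sub>R (y + \<delta> *\<^sub>R d)"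
        by (simp add: algebra_simps flip: scaleR_add_left)
    qed auto
    then show False using ext mem[of "- \<delta>"] mem[of \<delta>] \<delta>(1) unfolding extreme_point_of_def by auto
  qed
  then show ?thesis using 3(1) by simp
qed simp_all

lemma extreme_points_polar:
  "{y. y extreme_point_of polar (convex hull arrow_vectors)} = filter_vectors"
proof (intro equalityI subsetI)
  fix y assume "y \<in> {y. y extreme_point_of polar (convex hull arrow_vectors)}"
  then have ext: "y extreme_point_of polar (convex hull arrow_vectors)" by simp
  then have yP: "y \<in> polar (convex hull arrow_vectors)" by (simp add: extreme_point_of_def)
  have n: "0 < real n" using r_less_n by simp
  have "level y t - level y s \<in> {0, real n}" if st: "(s, t) \<in> arrows" for s t
  proof -
    have "level y s \<in> {0, real n}"
      by (rule extreme_point_levels[OF ext arrow_vertices(1)[OF st]])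
    moreover have "level y t \<in> {0, real n}"
      by (rule extreme_point_levels[OF ext arrow_vertices(2)[OF st]])
    moreover have "level y s \<le> level y t" using yP st by (auto simp: mem_polar_iff)
    ultimately show ?thesis using n by auto
  qed
  then show "y \<in> filter_vectors" by (auto simp: mem_filter_vectors_iff)
qed (simp add: filter_vector_extreme)

section \<open>Primitivity of the vertices\<close>

lemma filter_vectors_subset_lattice: "filter_vectors \<subseteq> int_span Basis"
  unfolding int_span_Basis
proof (intro subsetI CollectI ballI)
  fix y b assume y: "y \<in> filter_vectors" and "b \<in> (Basis :: 'a set)"
  then obtain i j where ij: "(i, j) \<in> boxes" "b = e (i, j)" using box_of_Basis by blast
  have "y \<bullet> b = level y (Box i j) - real_of_int (ht (Box i j))" using ij by (simp add: level_Box)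
  moreover have "level y (Box i j) \<in> \<int>" using level_filter_vector[OF y ij(1)] by auto
  ultimately show "y \<bullet> b \<in> \<int>" by (simp add: Ints_diff)
qed

lemma corner_boxes: "(1, 1) \<in> boxes" "(r, n - r) \<in> boxes"
  using r_less_n r_pos by auto

text \<open>
  If the filter is not the whole grid, the coordinate at the top left box is \<open>-1\<close>; for the whole grid
  the coordinate at the bottom right box is \<open>n - (n - 1)\<close>.
\<close>

lemma filter_vector_unit_coordinate:
  assumes y: "y \<in> filter_vectors"
  obtains b where "b \<in> Basis" "\<bar>y \<bullet> b\<bar> = 1"
proof -
  have lev: "level y (Box 1 1) = 0 \<or> level y (Box 1 1) = real n"
    using level_filter_vector[OF y corner_boxes(1)] by blast
  show thesis
  proof (cases "level y (Box 1 1) = 0")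
    case True
    then have "\<bar>y \<bullet> e (1, 1)\<bar> = 1" by (simp add: level_Box)
    then show ?thesis using that e_in_Basis corner_boxes(1) by blast
  next
    case False
    have "Box r (n - r) = Upper \<or> level y (Box r (n - r)) = real n"
      using corner_boxes(2)
    proof (rule forward_induct[where Q = "\<lambda>v. v = Upper \<or> level y v = real n"])
      fix s t assume st: "(s, t) \<in> arrows" and s: "s = Upper \<or> level y s = real n"
      show "t = Upper \<or> level y t = real n"
      proof (cases "s = Upper")
        case True
        from st True have "t = Box 1 1" by (cases rule: quiver_arrow_cases) auto
        then show ?thesis using False lev by simp
      next
        case False
        then have "real n \<le> level y t"
          using s y st filter_vectors_subset_polar by (force simp: mem_polar_iff)
        moreover have "level y t \<in> {0, real n}"
          using extreme_point_levels[OF filter_vector_extreme[OF y]] arrow_vertices(2)[OF st] .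
        ultimately show ?thesis using r_less_n by auto
      qed
    qed simp
    then have "y \<bullet> e (r, n - r) = 1"
      using r_less_n by (simp add: level_Box of_nat_diff)
    then show ?thesis using that[of "e (r, n - r)"] e_in_Basis corner_boxes(2) by auto
  qed
qed

lemma primitive_filter_vector:
  assumes y: "y \<in> filter_vectors" and \<Lambda>: "y \<in> \<Lambda>" "\<Lambda> \<subseteq> int_span Basis"
  shows "primitive_vector \<Lambda> y"
  unfolding primitive_vector_def
proof (intro conjI allI impI notI)
  obtain b where b: "b \<in> Basis" "\<bar>y \<bullet> b\<bar> = 1" using filter_vector_unit_coordinate[OF y] .
  show "y \<in> \<Lambda>" by fact
  show False if "y = 0" using b(2) that by simp
  fix t :: real assume t: "0 < t \<and> t < 1" "t *\<^sub>R y \<in> \<Lambda>"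
  then have "t * (y \<bullet> b) \<in> \<int>" using \<Lambda>(2) b(1) by (force simp: int_span_Basis)
  then have "\<bar>t * (y \<bullet> b)\<bar> \<in> \<int>" by simp
  then have "t \<in> \<int>" using b(2) t(1) by (simp add: abs_mult)
  then show False using t(1) by (auto elim!: Ints_cases)
qed

section \<open>Embedding the arrow vectors among the filter vectors\<close>

text \<open>
  The map \<open>\<phi>\<close> with matrix \<open>n * path_form - ht * ht\<close>.  It sends the vector of an arrow to \<open>n \<cdot> 1\<^sub>F - \<rho>\<close>,
  where \<open>F\<close> is the filter assigned to the arrow: the path heights of the endpoints differ by \<open>1\<close>.
\<close>

definition dual_embedding :: "'a \<Rightarrow> 'a" where
  "dual_embedding x = (\<Sum>p\<in>boxes. \<Sum>q\<in>boxes. ((x \<bullet> e p) *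
     real_of_int (int n * path_form n (case_prod Box p) (case_prod Box q)
       - ht (case_prod Box p) * ht (case_prod Box q))) *\<^sub>R e q)"

lemma linear_dual_embedding: "linear dual_embedding"
proof -
  have "linear (\<lambda>x. ((x \<bullet> a) * c) *\<^sub>R b)" for a b :: 'a and c
    by (intro linearI) (simp_all add: algebra_simps)
  then show ?thesis
    unfolding dual_embedding_def by (intro linear_compose_sum ballI)
qed

lemma inner_e:
  assumes "p \<in> boxes" "q \<in> boxes"
  shows "e p \<bullet> e q = (if p = q then 1 else 0)"
proof -
  have "e p \<in> Basis" "e q \<in> Basis" using assms e unfolding bij_betw_def by blast+
  moreover have "e p = e q \<longleftrightarrow> p = q"
    using e assms unfolding bij_betw_def by (metis inj_onD)
  ultimately show ?thesis by (simp add: inner_Basis)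
qed

lemma inner_dual_embedding_e:
  assumes "p \<in> boxes" "q \<in> boxes"
  shows "dual_embedding (e p) \<bullet> e q =
    real_of_int (int n * path_form n (case_prod Box p) (case_prod Box q)
       - ht (case_prod Box p) * ht (case_prod Box q))"
proof -
  let ?M = "\<lambda>p q. real_of_int (int n * path_form n (case_prod Box p) (case_prod Box q)
       - ht (case_prod Box p) * ht (case_prod Box q))"
  have "dual_embedding (e p) \<bullet> e q = (\<Sum>p'\<in>boxes. \<Sum>q'\<in>boxes. (e p \<bullet> e p') * ?M p' q' * (e q' \<bullet> e q))"
    unfolding dual_embedding_def by (simp add: inner_sum_left)
  also have "\<dots> = (\<Sum>p'\<in>boxes. \<Sum>q'\<in>boxes. if q' = q then (if p' = p then ?M p' q' else 0) else 0)"
    using assms by (intro sum.cong HOL.refl) (auto simp: inner_e simp del: of_int_diff of_int_mult)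
  also have "\<dots> = ?M p q" using assms by simp
  finally show ?thesis .
qed

text \<open>
  The matrix extends to the external vertices, whose vectors are \<open>0\<close>, because \<open>path_form\<close> has the
  boundary values \<open>0\<close> and \<open>path_height\<close> there and \<open>Rightmost\<close> has height \<open>n\<close>.
\<close>

lemma inner_dual_embedding:
  assumes "v \<in> vertices" "v' \<in> vertices"
  shows "dual_embedding (vec_of v) \<bullet> vec_of v' = real_of_int (int n * path_form n v v' - ht v * ht v')"
proof -
  have 0: "dual_embedding 0 = 0" by (rule linear_0[OF linear_dual_embedding])
  show ?thesis
    by (rule vertex_cases[OF assms(1)]; rule vertex_cases[OF assms(2)])
      (use inner_dual_embedding_e in \<open>auto simp: 0\<close>)
qed

lemma inner_dual_embedding_arrow_vectors:
  assumes w: "w \<in> arrow_vectors" and w': "w' \<in> arrow_vectors"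
  shows "dual_embedding w \<bullet> w' \<in> {- 1, real n - 1}"
proof -
  obtain s t where st: "(s, t) \<in> arrows" "w = arrow_vector s t" using w by (auto simp: arrow_vectors_def)
  obtain s' t' where st': "(s', t') \<in> arrows" "w' = arrow_vector s' t'"
    using w' by (auto simp: arrow_vectors_def)
  note V = arrow_vertices[OF st(1)] arrow_vertices[OF st'(1)]
  let ?D = "path_form n t t' - path_form n s t' - path_form n t s' + path_form n s s'"
  have "dual_embedding w = dual_embedding (vec_of t) - dual_embedding (vec_of s)"
    unfolding st(2) arrow_vector_def
    using linear_diff[OF linear_dual_embedding, of "vec_of t" "vec_of s"] by simp
  then have "dual_embedding w \<bullet> w' =
      real_of_int (int n * path_form n t t' - ht t * ht t') - real_of_int (int n * path_form n s t' - ht s * ht t')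
    - real_of_int (int n * path_form n t s' - ht t * ht s') + real_of_int (int n * path_form n s s' - ht s * ht s')"
    using V by (simp add: st'(2) arrow_vector_def inner_diff_right inner_diff_left inner_dual_embedding del: of_int_diff)
  also have "\<dots> = real_of_int (int n * ?D - (ht t - ht s) * (ht t' - ht s'))"
    by (simp add: algebra_simps)
  also have "\<dots> = real n * real_of_int ?D - 1"
    using path_height_arrow[OF r_less_n st(1)] path_height_arrow[OF r_less_n st'(1)] by simp
  finally show ?thesis
    using path_form_mixed_difference[OF r_less_n st(1) st'(1)] by auto
qed

lemma dual_embedding_arrow_vector: "w \<in> arrow_vectors \<Longrightarrow> dual_embedding w \<in> filter_vectors"
  using inner_dual_embedding_arrow_vectors by (simp add: filter_vectors_def)

section \<open>The image of the standard lattice\<close>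

lemma vertex_vector_in_lattice: "v \<in> vertices \<Longrightarrow> vec_of v \<in> int_span Basis"
  by (erule vertex_cases) (use e_in_Basis in \<open>auto simp: int_span_0 intro!: int_span_base\<close>)

lemma arrow_vector_in_lattice: "(s, t) \<in> arrows \<Longrightarrow> arrow_vector s t \<in> int_span Basis"
  using int_span_diff[OF vertex_vector_in_lattice vertex_vector_in_lattice, of t s] arrow_vertices
  by (simp add: arrow_vector_def)

abbreviation embedded_lattice :: "'a set" where
  "embedded_lattice \<equiv> int_span (dual_embedding ` Basis)"

lemma embedded_arrow_vector: "(s, t) \<in> arrows \<Longrightarrow> dual_embedding (arrow_vector s t) \<in> embedded_lattice"
  using arrow_vector_in_lattice by (simp add: int_span_linear_image[OF linear_dual_embedding])

lemma level_embedded_arrow_vector: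
  assumes st: "(s, t) \<in> arrows" and ij: "(i, j) \<in> boxes"
  shows "level (dual_embedding (arrow_vector s t)) (Box i j) =
    real n * real_of_int (path_form n t (Box i j) - path_form n s (Box i j))"
proof -
  have "dual_embedding (arrow_vector s t) = dual_embedding (vec_of t) - dual_embedding (vec_of s)"
    unfolding arrow_vector_def
    using linear_diff[OF linear_dual_embedding, of "vec_of t" "vec_of s"] by simp
  then have "level (dual_embedding (arrow_vector s t)) (Box i j) =
      real_of_int (int n * path_form n t (Box i j) - ht t * ht (Box i j))
      - real_of_int (int n * path_form n s (Box i j) - ht s * ht (Box i j)) + real_of_int (ht (Box i j))"
    unfolding level_def inner_diff_left
    using inner_dual_embedding[OF arrow_vertices(1)[OF st] Box_in_vertices[OF ij]]
      inner_dual_embedding[OF arrow_vertices(2)[OF st] Box_in_vertices[OF ij]]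
    by (simp only: inner_diff_left)
  also have "\<dots> = real_of_int (int n * (path_form n t (Box i j) - path_form n s (Box i j))
      - (ht t - ht s - 1) * ht (Box i j))"
    by (simp add: algebra_simps)
  also have "ht t - ht s - 1 = 0" using path_height_arrow[OF r_less_n st] by simp
  finally show ?thesis by simp
qed

lemma eq_if_coordinates_eq:
  assumes "\<And>p. p \<in> boxes \<Longrightarrow> x \<bullet> e p = y \<bullet> e p"
  shows "x = y"
proof (rule euclidean_eqI)
  fix b :: 'a assume "b \<in> Basis"
  then obtain i j where "(i, j) \<in> boxes" "b = e (i, j)" using box_of_Basis by blast
  then show "x \<bullet> b = y \<bullet> b" using assms by simp
qed

text \<open>
  Two arrows whose filters differ by the single box \<open>(i, j)\<close> give \<open>n\<close> times its basis vector.
\<close>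

lemma scaled_basis_vector_by_two_arrows:
  assumes st: "(s, t) \<in> arrows" and st': "(s', t') \<in> arrows" and ij: "(i, j) \<in> boxes"
    and diff: "\<And>p q. (p, q) \<in> boxes \<Longrightarrow> path_form n t (Box p q) - path_form n s (Box p q)
      - (path_form n t' (Box p q) - path_form n s' (Box p q)) = (if p = i \<and> q = j then 1 else 0)"
  shows "real n *\<^sub>R e (i, j) \<in> embedded_lattice"
proof -
  have "real n *\<^sub>R e (i, j) = dual_embedding (arrow_vector s t) - dual_embedding (arrow_vector s' t')"
  proof (rule eq_if_coordinates_eq)
    fix b assume "b \<in> boxes"
    then obtain p q where b: "b = (p, q)" "(p, q) \<in> boxes" by (cases b) auto
    let ?F = "\<lambda>s t. path_form n t (Box p q) - path_form n s (Box p q)"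
    have "(dual_embedding (arrow_vector s t) - dual_embedding (arrow_vector s' t')) \<bullet> e (p, q) =
        level (dual_embedding (arrow_vector s t)) (Box p q) - level (dual_embedding (arrow_vector s' t')) (Box p q)"
      by (simp add: level_Box inner_diff_left)
    also have "\<dots> = real n * real_of_int (?F s t - ?F s' t')"
      unfolding level_embedded_arrow_vector[OF st b(2)] level_embedded_arrow_vector[OF st' b(2)]
      by (simp add: algebra_simps)
    also have "\<dots> = (real n *\<^sub>R e (i, j)) \<bullet> e (p, q)"
      unfolding diff[OF b(2)] using inner_e[OF ij b(2)] by auto
    finally show "(real n *\<^sub>R e (i, j)) \<bullet> e b =
        (dual_embedding (arrow_vector s t) - dual_embedding (arrow_vector s' t')) \<bullet> e b"
      using b(1) by simp
  qed
  then show ?thesis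
    using int_span_diff[OF embedded_arrow_vector[OF st] embedded_arrow_vector[OF st']] by simp
qed

text \<open>
  Two lists of filters in which consecutive members differ by one box: starting with the whole grid,
  the filters of the down arrows, row by row and from left to right, lose the boxes above the bottom
  row; and after the filter of the right arrow into \<open>Box r j\<close>, that of the first right arrow out of
  column \<open>j\<close>, or the empty one if \<open>j\<close> is the last column, lacks in addition \<open>(r, j)\<close>.
\<close>

lemma scaled_basis_vector_except_corner:
  assumes ij: "(i, j) \<in> boxes" "(i, j) \<noteq> (r, 1)"
  shows "real n *\<^sub>R e (i, j) \<in> embedded_lattice"
proof -
  have b: "1 \<le> i" "i \<le> r" "1 \<le> j" "j \<le> n - r" using ij(1) by auto
  consider (inner) "i < r" "2 \<le> j" | (left) "i < r" "j = 1" "2 \<le> i" | (corner) "i < r" "j = 1" "i = 1"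
    | (bottom) "i = r" "2 \<le> j" "j < n - r" | (last) "i = r" "2 \<le> j" "j = n - r"
  proof -
    have "i < r \<and> 2 \<le> j \<or> i < r \<and> j = 1 \<and> 2 \<le> i \<or> i < r \<and> j = 1 \<and> i = 1 \<or>
        i = r \<and> 2 \<le> j \<and> j < n - r \<or> i = r \<and> 2 \<le> j \<and> j = n - r"
      using b ij(2) by auto
    then show thesis using that by (elim disjE conjE) simp_all
  qed
  then show ?thesis
  proof cases
    case inner
    then show ?thesis
      using b down_arrow[of i "j - 1"] down_arrow[of i j] ij(1)
      by (intro scaled_basis_vector_by_two_arrows[of "Box i (j - 1)" "Box (i + 1) (j - 1)" "Box i j" "Box (i + 1) j"])
        (auto simp: min_def)
  next
    case left
    then show ?thesis
      using b down_arrow[of "i - 1" "n - r"] down_arrow[of i 1] ij(1)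
      by (intro scaled_basis_vector_by_two_arrows[of "Box (i - 1) (n - r)" "Box i (n - r)" "Box i 1" "Box (i + 1) 1"])
        (auto simp: min_def)
  next
    case corner
    then show ?thesis
      using b start_arrow down_arrow[of 1 1] ij(1)
      by (intro scaled_basis_vector_by_two_arrows[of Upper "Box 1 1" "Box 1 1" "Box (1 + 1) 1"])
        (auto simp: min_def)
  next
    case bottom
    then show ?thesis
      using b right_arrow[of r "j - 1"] right_arrow[of 1 j] ij(1)
      by (intro scaled_basis_vector_by_two_arrows[of "Box r (j - 1)" "Box r j" "Box 1 j" "Box 1 (j + 1)"])
        (auto simp: min_def)
  next
    case last
    have "(Box r (j - 1), Box r (j - 1 + 1)) \<in> arrows"
      by (rule right_arrow) (use last r_pos in auto)
    moreover have "j - 1 + 1 = j" using last by simp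
    ultimately have "(Box r (j - 1), Box r j) \<in> arrows" by (simp only:)
    then show ?thesis
      using last b final_arrow ij(1)
      by (intro scaled_basis_vector_by_two_arrows[of "Box r (j - 1)" "Box r j" "Box r (n - r)" Rightmost])
        (auto simp: min_def)
  qed
qed

lemma inner_sum_e:
  assumes "B \<subseteq> boxes" "p \<in> boxes"
  shows "(\<Sum>q\<in>B. c q *\<^sub>R e q) \<bullet> e p = (if p \<in> B then c p else 0)"
proof -
  have fin: "finite B" using assms(1) by (rule finite_subset) simp
  have "(\<Sum>q\<in>B. c q *\<^sub>R e q) \<bullet> e p = (\<Sum>q\<in>B. if q = p then c q else 0)"
    unfolding inner_sum_left
  proof (rule sum.cong[OF HOL.refl])
    fix q assume "q \<in> B"
    then have "q \<in> boxes" using assms(1) by blast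
    then show "c q *\<^sub>R e q \<bullet> e p = (if q = p then c q else 0)"
      using inner_e[OF _ assms(2)] by simp
  qed
  then show ?thesis using fin by simp
qed

text \<open>
  For the bottom left box, use that the filters at both ends of a path, the whole grid and the empty set,
  differ by the sum of all boxes.
\<close>

lemma scaled_basis_vector:
  assumes "p \<in> boxes"
  shows "real n *\<^sub>R e p \<in> embedded_lattice"
proof (cases "p = (r, 1)")
  case False
  then show ?thesis using scaled_basis_vector_except_corner assms by (cases p) auto
next
  case True
  let ?u = "dual_embedding (arrow_vector Upper (Box 1 1))"
  let ?z = "dual_embedding (arrow_vector (Box r (n - r)) Rightmost)"
  have "real n *\<^sub>R e p = ?u - ?z - (\<Sum>q\<in>boxes - {(r, 1)}. real n *\<^sub>R e q)"
  proof (rule eq_if_coordinates_eq)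
    fix b assume bb: "b \<in> boxes"
    then obtain i j where b: "b = (i, j)" "(i, j) \<in> boxes" by (cases b) auto
    have "(?u - ?z) \<bullet> e (i, j) = level ?u (Box i j) - level ?z (Box i j)"
      by (simp add: level_Box inner_diff_left)
    also have "\<dots> = real n"
      unfolding level_embedded_arrow_vector[OF start_arrow b(2)] level_embedded_arrow_vector[OF final_arrow b(2)]
      using b(2) by (auto simp: min_def)
    finally have "(?u - ?z) \<bullet> e b = real n" using b(1) by simp
    moreover have "(\<Sum>q\<in>boxes - {(r, 1)}. real n *\<^sub>R e q) \<bullet> e b = (if b = p then 0 else real n)"
      using inner_sum_e[of "boxes - {(r, 1)}" b "\<lambda>_. real n"] bb True by auto
    moreover have "(real n *\<^sub>R e p) \<bullet> e b = (if b = p then real n else 0)"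
      using inner_e[OF assms bb] by simp
    ultimately show "(real n *\<^sub>R e p) \<bullet> e b = (?u - ?z - (\<Sum>q\<in>boxes - {(r, 1)}. real n *\<^sub>R e q)) \<bullet> e b"
      unfolding inner_diff_left[of "?u - ?z"] by simp
  qed
  moreover have "(\<Sum>q\<in>boxes - {(r, 1)}. real n *\<^sub>R e q) \<in> embedded_lattice"
  proof (rule int_span_sum)
    fix q assume "q \<in> boxes - {(r, 1)}"
    then show "real n *\<^sub>R e q \<in> embedded_lattice"
      using scaled_basis_vector_except_corner[of "fst q" "snd q"] by simp
  qed
  ultimately show ?thesis
    using embedded_arrow_vector start_arrow final_arrow by (simp add: int_span_diff)
qed

lemma filter_vectors_subset_embedded_lattice: "filter_vectors \<subseteq> embedded_lattice"
proof
  fix y assume y: "y \<in> filter_vectors"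
  let ?z = "dual_embedding (arrow_vector (Box r (n - r)) Rightmost)"
  let ?F = "{p \<in> boxes. level y (case_prod Box p) = real n}"
  have eq: "y = (\<Sum>q\<in>?F. real n *\<^sub>R e q) + ?z"
  proof (rule eq_if_coordinates_eq)
    fix b assume bb: "b \<in> boxes"
    then obtain i j where b: "b = (i, j)" "(i, j) \<in> boxes" by (cases b) auto
    have "level ?z (Box i j) = 0"
      unfolding level_embedded_arrow_vector[OF final_arrow b(2)] using b(2) by (auto simp: min_def)
    then have "(?z - y) \<bullet> e b = - level y (Box i j)"
      by (simp add: b(1) level_Box inner_diff_left)
    then show "y \<bullet> e b = ((\<Sum>q\<in>?F. real n *\<^sub>R e q) + ?z) \<bullet> e b"
      using inner_sum_e[of ?F b "\<lambda>_. real n"] bb level_filter_vector[OF y b(2)] b(1)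
      by (auto simp: inner_add_left inner_diff_left)
  qed
  moreover have "(\<Sum>q\<in>?F. real n *\<^sub>R e q) \<in> embedded_lattice"
    by (rule int_span_sum) (use scaled_basis_vector in auto)
  ultimately show "y \<in> embedded_lattice"
    by (subst eq) (rule int_span_add[OF _ embedded_arrow_vector[OF final_arrow]])
qed

lemma embedded_lattice_eq: "embedded_lattice = int_span filter_vectors"
proof
  have box: "dual_embedding (vec_of (Box i j)) \<in> int_span filter_vectors" if ij: "(i, j) \<in> boxes" for i j
    using ij
  proof (rule forward_induct[where Q = "\<lambda>v. dual_embedding (vec_of v) \<in> int_span filter_vectors"])
    show "dual_embedding (vec_of Upper) \<in> int_span filter_vectors"
      by (simp add: linear_0[OF linear_dual_embedding] int_span_0)
    fix s t assume st: "(s, t) \<in> arrows" and s: "dual_embedding (vec_of s) \<in> int_span filter_vectors"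
    have "dual_embedding (vec_of t) = dual_embedding (vec_of s) + dual_embedding (arrow_vector s t)"
      by (simp add: arrow_vector_def flip: linear_add[OF linear_dual_embedding])
    moreover have "dual_embedding (arrow_vector s t) \<in> filter_vectors"
      using st by (intro dual_embedding_arrow_vector) (auto simp: arrow_vectors_def)
    ultimately show "dual_embedding (vec_of t) \<in> int_span filter_vectors"
      using s by (simp add: int_span_add int_span_base)
  qed
  show "embedded_lattice \<subseteq> int_span filter_vectors"
  proof (intro int_span_subset image_subsetI)
    fix b :: 'a assume "b \<in> Basis"
    then obtain i j where "(i, j) \<in> boxes" "b = e (i, j)" using box_of_Basis by blast
    then show "dual_embedding b \<in> int_span filter_vectors" using box by simp
  qed
  show "int_span filter_vectors \<subseteq> embedded_lattice"
    by (intro int_span_subset filter_vectors_subset_embedded_lattice)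
qed

lemma bij_dual_embedding: "bij dual_embedding"
proof -
  have "b \<in> range dual_embedding" if b: "b \<in> Basis" for b
  proof -
    obtain i j where ij: "(i, j) \<in> boxes" "b = e (i, j)" using box_of_Basis[OF b] by blast
    then obtain x where "real n *\<^sub>R b = dual_embedding x"
      using scaled_basis_vector[OF ij(1)] by (auto simp: int_span_linear_image[OF linear_dual_embedding])
    then have "dual_embedding (x /\<^sub>R real n) = b"
      using r_less_n by (simp add: linear_cmul[OF linear_dual_embedding] flip: \<open>_ = dual_embedding x\<close>)
    then show ?thesis by (metis rangeI)
  qed
  then have "span (Basis :: 'a set) \<subseteq> range dual_embedding"
    using linear_subspace_image[OF linear_dual_embedding subspace_UNIV] by (intro span_minimal) auto
  then have "surj dual_embedding" by (simp add: subset_antisym)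
  then show ?thesis
    using linear_surjective_imp_injective[OF linear_dual_embedding] by (simp add: bij_def)
qed

section \<open>Comparison of $P_{n,r}$ and $Q_{n,r}$\<close>

lemma Q_polytope_eq: "Q_polytope n r e = (int_span filter_vectors, polar (convex hull arrow_vectors))"
  by (simp add: Q_polytope_def P_polytope_eq primitive_dual_def extreme_points_polar)

lemma polytope_hull: "polytope (convex hull arrow_vectors)"
  using finite_arrow_vectors by (auto simp: polytope_def)

lemma blowup_of_P_is_VGIT_of_Q:
  "\<exists>X. toric_blowup (toric_variety_of (P_polytope n r e)) X \<and>
       toric_VGIT (toric_variety_of (Q_polytope n r e)) X"
  unfolding P_polytope_eq Q_polytope_eq
proof (rule blowup_related_by_toric_VGIT[OF independent_Basis span_Basis linear_dual_embedding bij_dual_embedding])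
  show "dual_embedding ` int_span Basis = int_span filter_vectors"
    using embedded_lattice_eq by (simp add: int_span_linear_image[OF linear_dual_embedding])
  show "dual_embedding v extreme_point_of polar (convex hull arrow_vectors)"
    if "v extreme_point_of convex hull arrow_vectors" for v
    using extreme_point_of_convex_hull[OF that] dual_embedding_arrow_vector filter_vector_extreme by blast
  show "primitive_vector (int_span filter_vectors) v"
    if "v extreme_point_of polar (convex hull arrow_vectors)" for v
    using that extreme_points_polar filter_vectors_subset_lattice
    by (intro primitive_filter_vector int_span_base int_span_subset) blast+
qed (intro polytope_hull zero_in_interior_hull polytope_polar zero_in_interior_dual)+

lemma adjoint_dual_embedding: "adjoint dual_embedding x \<bullet> y = x \<bullet> dual_embedding y"
  using adjoint_clauses(2)[OF linear_dual_embedding] .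

lemma bij_adjoint_dual_embedding: "bij (adjoint dual_embedding)"
proof -
  have "x = 0" if "adjoint dual_embedding x = 0" for x
  proof -
    obtain y where "x = dual_embedding y" using bij_dual_embedding by (metis bij_pointE)
    then have "x \<bullet> x = 0" using adjoint_dual_embedding[of x y] that by simp
    then show ?thesis by simp
  qed
  then have "inj (adjoint dual_embedding)"
    using linear_injective_0[OF adjoint_linear[OF linear_dual_embedding]] by blast
  then show ?thesis
    using linear_injective_imp_surjective[OF adjoint_linear[OF linear_dual_embedding]] by (simp add: bij_def)
qed

lemma adjoint_dual_lattice: "adjoint dual_embedding ` dual_lattice (int_span filter_vectors) = int_span Basis"
proof -
  have "x \<in> dual_lattice (int_span filter_vectors) \<longleftrightarrow> adjoint dual_embedding x \<in> int_span Basis" for x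
    unfolding embedded_lattice_eq[symmetric] dual_lattice_int_span int_span_Basis
    by (simp add: adjoint_dual_embedding)
  then show ?thesis using bij_is_surj[OF bij_adjoint_dual_embedding] by (auto simp: image_iff) (metis surjD)
qed

lemma blowup_of_dual_Q_is_VGIT_of_dual_P:
  "\<exists>Y. toric_blowup (toric_variety_of (dual_polytope (Q_polytope n r e))) Y \<and>
       toric_VGIT (toric_variety_of (dual_polytope (P_polytope n r e))) Y"
proof -
  let ?\<psi> = "adjoint dual_embedding"
  let ?G = "inv ?\<psi> ` Basis"
  have lin: "linear ?\<psi>" by (rule adjoint_linear[OF linear_dual_embedding])
  have inv: "linear (inv ?\<psi>)" "bij (inv ?\<psi>)"
    using lin bij_adjoint_dual_embedding by (simp_all add: inj_linear_imp_inv_linear bij_is_inj bij_imp_bij_inv)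
  have G: "independent ?G" "span ?G = UNIV"
    using inv by (simp_all add: linear_independent_injective_image bij_is_inj independent_Basis
      linear_span_image bij_is_surj)
  have \<Lambda>: "int_span ?G = dual_lattice (int_span filter_vectors)"
    unfolding int_span_linear_image[OF inv(1)] adjoint_dual_lattice[symmetric]
    by (simp add: image_image inv_f_f bij_is_inj bij_adjoint_dual_embedding)
  have eq: "dual_polytope (Q_polytope n r e) = (int_span ?G, convex hull arrow_vectors)"
    "dual_polytope (P_polytope n r e) = (int_span Basis, polar (convex hull arrow_vectors))"
    by (simp_all add: Q_polytope_eq P_polytope_eq dual_polytope_def bipolar \<Lambda> dual_lattice_Basis)
  show ?thesis
    unfolding eq
  proof (rule blowup_related_by_toric_VGIT[OF G lin bij_adjoint_dual_embedding])
    show "?\<psi> ` int_span ?G = int_span Basis" unfolding \<Lambda> by (rule adjoint_dual_lattice)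
    show "?\<psi> v extreme_point_of polar (convex hull arrow_vectors)"
      if "v extreme_point_of convex hull arrow_vectors" for v
    proof (rule filter_vector_extreme)
      show "?\<psi> v \<in> filter_vectors"
        using extreme_point_of_convex_hull[OF that] inner_dual_embedding_arrow_vectors
        by (simp add: filter_vectors_def adjoint_dual_embedding inner_commute[of v])
    qed
    show "primitive_vector (int_span Basis) v"
      if "v extreme_point_of polar (convex hull arrow_vectors)" for v
      using that extreme_points_polar filter_vectors_subset_lattice
      by (intro primitive_filter_vector) blast+
  qed (intro polytope_hull zero_in_interior_hull polytope_polar zero_in_interior_dual)+
qed

end

theorem theorem0p2:
  fixes n r :: nat and e :: "nat \<times> nat \<Rightarrow> 'a::euclidean_space"
  assumes "n > r" and "r > 0"
    and "bij_betw e ({1..r} \<times> {1..n - r}) Basis"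
  shows "(\<exists>X. toric_blowup (toric_variety_of (P_polytope n r e)) X \<and>
              toric_VGIT (toric_variety_of (Q_polytope n r e)) X) \<and>
         (\<exists>Y. toric_blowup (toric_variety_of (dual_polytope (Q_polytope n r e))) Y \<and>
              toric_VGIT (toric_variety_of (dual_polytope (P_polytope n r e))) Y)"
proof -
  interpret grid_quiver n r e using assms by unfold_locales
  show ?thesis using blowup_of_P_is_VGIT_of_Q blowup_of_dual_Q_is_VGIT_of_dual_P by blast
qed

end
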